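(* Let $J$ be a nonzero two-sided ideal of $\mathrm{U}(W_+)$ such that $\operatorname{gr}_o(\operatorname{gr}_d(J))$ is a radical ideal of $\mathrm{S}(W_+)$. Then $\operatorname{GKdim}\mathrm{U}(W_+)/J<\infty$.
   Context: $\Bbbk$ is a field of characteristic zero. The positive Witt algebra $W_+$ is the Lie algebra over $\Bbbk$ with basis $\{e_n : n\in\mathbb{Z}_{\geq 1}\}$ and bracket $[e_i,e_j]=(j-i)e_{i+j}$; $\mathrm{U}(W_+)$ is its universal enveloping algebra and $\mathrm{S}(W_+)$ its symmetric algebra. The degree grading $d$ on $\mathrm{U}(W_+)$ has $d(e_i)=i$. The order filtration $o$ on $\mathrm{U}(W_+)$ is the standard filtration with $o(e_i)=1$; its associated graded ring is $\mathrm{S}(W_+)$. For a two-sided ideal $J$ of $\mathrm{U}(W_+)$, $\operatorname{gr}_d(J)$ is the two-sided ideal of $\mathrm{U}(W_+)$ spanned by the top-$d$-degree homogeneous components of elements of $J$, and $\operatorname{gr}_o(J)\subseteq\mathrm{S}(W_+)$ is the ideal spanned by leading symbols, with respect to $o$, of elements of $J$. $\operatorname{GKdim}R=\sup_V\limsup_{n}\log_n\dim_\Bbbk\left(\sum_{k=0}^nV^k\right)$ over finite-dimensional subspaces $V$ of the $\Bbbk$-algebra $R$ (it is $-\infty$ for the zero algebra, which counts as $<\infty$). *)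

theory Defs
  imports
    "HOL-Algebra.Algebraic_Closure_Type"
    "HOL-Algebra.QuotRing"
    "HOL-Library.Poly_Mapping"
    "HOL-Library.Extended_Real"
    "HOL-Library.Liminf_Limsup"
begin

section \<open>Algebras over a field\<close>

text \<open>
  A \<open>k\<close>-algebra is given here by a ring \<open>R\<close> together with the set \<open>K \<subseteq> carrier R\<close> of its
  scalars, i.e. the image \<open>{c \<cdot> 1 | c \<in> k}\<close> of the ground field.  The library predicate
  \<^const>\<open>subalgebra\<close> (\<open>subalgebra K V R\<close>) says that \<open>V\<close> is a \<open>K\<close>-linear subspace of \<open>R\<close>;
  it does not ask for closure under products.
\<close>

definition lin_span :: "'a set \<Rightarrow> ('a, 'b) ring_scheme \<Rightarrow> 'a set \<Rightarrow> 'a set" where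
  "lin_span K R S = \<Inter>{V. subalgebra K V R \<and> S \<subseteq> V}"

primrec space_power :: "'a set \<Rightarrow> ('a, 'b) ring_scheme \<Rightarrow> 'a set \<Rightarrow> nat \<Rightarrow> 'a set" where
  "space_power K R V 0 = K"
| "space_power K R V (Suc n) =
     lin_span K R {x \<otimes>\<^bsub>R\<^esub> y | x y. x \<in> space_power K R V n \<and> y \<in> V}"

definition ereal_log :: "nat \<Rightarrow> nat \<Rightarrow> ereal" where
  "ereal_log n d = (if d = 0 then - \<infinity> else ereal (log (real n) (real d)))"

text \<open>
  For the zero ring, where \<open>K = {\<zero>}\<close> is not a subfield, \<open>ring.dim R K {\<zero>}\<close> is still \<open>0\<close>,
  so that the value of \<open>GKdim\<close> is \<open>- \<infinity>\<close>.
\<close>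

definition GKdim :: "'a set \<Rightarrow> ('a, 'b) ring_scheme \<Rightarrow> ereal" where
  "GKdim K R =
     (SUP V \<in> {V. subalgebra K V R \<and> ring.finite_dimension R K V}.
        limsup (\<lambda>n. ereal_log n
          (ring.dim R K (lin_span K R (\<Union>k\<le>n. space_power K R V k)))))"

definition radical :: "'a set \<Rightarrow> ('a, 'b) ring_scheme \<Rightarrow> 'a set" where
  "radical I R = {x \<in> carrier R. \<exists>n::nat. n > 0 \<and> x [^]\<^bsub>R\<^esub> n \<in> I}"

definition radical_ideal :: "'a set \<Rightarrow> ('a, 'b) ring_scheme \<Rightarrow> bool" where
  "radical_ideal I R \<longleftrightarrow> ideal I R \<and> radical I R = I"


section \<open>The positive Witt algebra\<close>

typedef pnat = "{n::nat. 1 \<le> n}"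
  morphisms nat_of_pnat pnat_of_nat
  by auto

setup_lifting type_definition_pnat

instantiation pnat :: ab_semigroup_add
begin

lift_definition plus_pnat :: "pnat \<Rightarrow> pnat \<Rightarrow> pnat" is "(+)"
  by simp

instance
  by standard (transfer; simp)+

end

text \<open>The finitely supported function \<open>x\<close> stands for \<open>\<Sum>n. x n \<cdot> e n\<close>.\<close>

type_synonym 'k witt = "pnat \<Rightarrow>\<^sub>0 'k"

definition bracket :: "'k::field_char_0 witt \<Rightarrow> 'k witt \<Rightarrow> 'k witt" where
  "bracket x y =
     (\<Sum>i\<in>Poly_Mapping.keys x. \<Sum>j\<in>Poly_Mapping.keys y.
        Poly_Mapping.single (i + j)
          (Poly_Mapping.lookup x i * Poly_Mapping.lookup y j * (of_nat (nat_of_pnat j) - of_nat (nat_of_pnat i))))"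

abbreviation basis_elt :: "pnat \<Rightarrow> 'k::field_char_0 witt" where
  "basis_elt i \<equiv> Poly_Mapping.single i 1"

lemma bracket_basis_elt:
  "bracket (basis_elt i) (basis_elt j) =
     Poly_Mapping.single (i + j)
       (of_nat (nat_of_pnat j) - of_nat (nat_of_pnat i) :: 'k::field_char_0)"
  by (simp add: bracket_def)


section \<open>The tensor algebra\<close>

text \<open>
  The tensor algebra of a vector space with basis \<open>'a\<close> is the monoid algebra of the free monoid
  on \<open>'a\<close>.  The latter is written additively, as required by the convolution product
  on \<open>\<Rightarrow>\<^sub>0\<close>.
\<close>

datatype 'a free_monoid = Word (letters: "'a list")

instantiation free_monoid :: (type) monoid_add
begin

definition zero_free_monoid :: "'a free_monoid" where
  "0 = Word []"

definition plus_free_monoid :: "'a free_monoid \<Rightarrow> 'a free_monoid \<Rightarrow> 'a free_monoid" where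
  "v + w = Word (letters v @ letters w)"

instance
  by standard (simp_all add: zero_free_monoid_def plus_free_monoid_def)

end

type_synonym 'k tensor = "pnat free_monoid \<Rightarrow>\<^sub>0 'k"

abbreviation TW :: "'k::field_char_0 tensor ring" where
  "TW \<equiv> ring_of_type_algebra"

definition tensor_of_witt :: "'k::field_char_0 witt \<Rightarrow> 'k tensor" where
  "tensor_of_witt x =
     (\<Sum>i\<in>Poly_Mapping.keys x. Poly_Mapping.single (Word [i]) (Poly_Mapping.lookup x i))"

definition word_degree :: "pnat free_monoid \<Rightarrow> nat" where
  "word_degree w = (\<Sum>i\<leftarrow>letters w. nat_of_pnat i)"

definition word_length :: "pnat free_monoid \<Rightarrow> nat" where
  "word_length w = length (letters w)"


section \<open>The universal enveloping algebra\<close>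

definition lie_relations :: "'k::field_char_0 tensor set" where
  "lie_relations =
     {tensor_of_witt x * tensor_of_witt y - tensor_of_witt y * tensor_of_witt x
        - tensor_of_witt (bracket x y) | x y. True}"

definition lie_ideal :: "'k::field_char_0 tensor set" where
  "lie_ideal = Idl\<^bsub>TW\<^esub> lie_relations"

definition UW :: "'k::field_char_0 tensor set ring" where
  "UW = TW Quot lie_ideal"

definition UW_class :: "'k::field_char_0 tensor \<Rightarrow> 'k tensor set" where
  "UW_class p = lie_ideal +>\<^bsub>TW\<^esub> p"

definition UW_scalars :: "'k::field_char_0 tensor set set" where
  "UW_scalars = range (\<lambda>c. UW_class (Poly_Mapping.single 0 c))"

definition UW_quot_scalars ::
  "'k::field_char_0 tensor set set \<Rightarrow> 'k tensor set set set" where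
  "UW_quot_scalars J = (\<lambda>c. J +>\<^bsub>UW\<^esub> c) ` UW_scalars"

lemma ring_ring_of_type_algebra: "ring (ring_of_type_algebra :: 'a::ring_1 ring)"
proof -
  have "\<exists>y. x + y = 0" for x :: 'a
    using add.right_inverse by blast
  then show ?thesis
    unfolding ring_of_type_algebra_def using add.right_inverse
    by unfold_locales (auto simp: algebra_simps Units_def)
qed

lemma ideal_lie_ideal: "ideal (lie_ideal :: 'k::field_char_0 tensor set) TW"
proof -
  interpret ring "TW :: 'k tensor ring" by (rule ring_ring_of_type_algebra)
  show ?thesis
    unfolding lie_ideal_def
    by (rule genideal_ideal) (simp add: ring_of_type_algebra_def)
qed

lemma ring_UW: "ring (UW :: 'k::field_char_0 tensor set ring)"
  unfolding UW_def by (rule ideal.quotient_is_ring[OF ideal_lie_ideal])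

lemma UW_class_hom: "UW_class \<in> ring_hom (TW :: 'k::field_char_0 tensor ring) UW"
  using ideal.rcos_ring_hom[OF ideal_lie_ideal[where 'k = 'k]]
  by (simp add: UW_def UW_class_def[abs_def])

lemma UW_class_commutator:
  "UW_class (tensor_of_witt x * tensor_of_witt y - tensor_of_witt y * tensor_of_witt x) =
   UW_class (tensor_of_witt (bracket x y) :: 'k::field_char_0 tensor)"
  (is "UW_class ?p = UW_class ?q")
proof -
  interpret I: ideal "lie_ideal :: 'k tensor set" "TW :: 'k tensor ring"
    by (rule ideal_lie_ideal)
  have add: "u \<oplus>\<^bsub>TW\<^esub> v = u + v" for u v :: "'k tensor"
    by (simp add: ring_of_type_algebra_def)
  have "?p - ?q \<in> lie_relations"
    unfolding lie_relations_def by blast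
  then have "?p - ?q \<in> lie_ideal"
    unfolding lie_ideal_def
    using I.genideal_self[of lie_relations] by (auto simp: ring_of_type_algebra_def)
  then have "?p \<in> lie_ideal +>\<^bsub>TW\<^esub> ?q"
    unfolding a_r_coset_def' by (auto simp: add intro!: bexI[of _ "?p - ?q"])
  then show ?thesis
    unfolding UW_class_def
    using I.a_repr_independence'[of ?p ?q] by (simp add: ring_of_type_algebra_def)
qed


section \<open>The symmetric algebra\<close>

type_synonym 'k symm = "(pnat \<Rightarrow>\<^sub>0 nat) \<Rightarrow>\<^sub>0 'k"

abbreviation SW :: "'k::field_char_0 symm ring" where
  "SW \<equiv> ring_of_type_algebra"

definition SW_scalars :: "'k::field_char_0 symm set" where
  "SW_scalars = range (Poly_Mapping.single 0)"

text \<open>The canonical projection from the tensor algebra onto the symmetric algebra.\<close>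

definition symm_of_tensor :: "'k::field_char_0 tensor \<Rightarrow> 'k symm" where
  "symm_of_tensor p =
     (\<Sum>w\<in>Poly_Mapping.keys p.
        Poly_Mapping.single (\<Sum>i\<leftarrow>letters w. Poly_Mapping.single i 1) (Poly_Mapping.lookup p w))"


section \<open>Associated graded ideals\<close>

definition degree_part :: "nat \<Rightarrow> 'k::field_char_0 tensor set set" where
  "degree_part n = UW_class ` {p. \<forall>w\<in>Poly_Mapping.keys p. word_degree w = n}"

definition degree_below :: "nat \<Rightarrow> 'k::field_char_0 tensor set set" where
  "degree_below n = UW_class ` {p. \<forall>w\<in>Poly_Mapping.keys p. word_degree w < n}"

text \<open>\<open>b\<close> is the (nonzero) homogeneous component of \<open>a\<close> of highest \<open>d\<close>-degree.\<close>

definition is_top_component ::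
  "'k::field_char_0 tensor set \<Rightarrow> 'k tensor set \<Rightarrow> bool" where
  "is_top_component a b \<longleftrightarrow>
     (\<exists>n. b \<in> degree_part n \<and> a \<notin> degree_below n \<and> a \<ominus>\<^bsub>UW\<^esub> b \<in> degree_below n)"

definition gr_d :: "'k::field_char_0 tensor set set \<Rightarrow> 'k tensor set set" where
  "gr_d J = lin_span UW_scalars UW {b. \<exists>a\<in>J. is_top_component a b}"

definition order_below :: "nat \<Rightarrow> 'k::field_char_0 tensor set set" where
  "order_below n = UW_class ` {p. \<forall>w\<in>Poly_Mapping.keys p. word_length w < n}"

text \<open>
  The identification of the associated graded ring of \<open>UW\<close> with \<open>SW\<close> sends the class of
  \<open>e i\<^sub>1 \<cdots> e i\<^sub>n\<close> modulo \<open>order_below n\<close> to the monomial \<open>e i\<^sub>1 \<cdots> e i\<^sub>n\<close> of \<open>SW\<close>.  Hence, if \<open>a\<close>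
  has order exactly \<open>n\<close> and agrees modulo \<open>order_below n\<close> with the class of a tensor \<open>q\<close>
  homogeneous of length \<open>n\<close>, then the leading symbol of \<open>a\<close> is the image of \<open>q\<close> in \<open>SW\<close>;
  it does not depend on \<open>q\<close> by the Poincare-Birkhoff-Witt theorem.
\<close>

definition is_leading_symbol ::
  "'k::field_char_0 tensor set \<Rightarrow> 'k symm \<Rightarrow> bool" where
  "is_leading_symbol a s \<longleftrightarrow>
     (\<exists>n q. (\<forall>w\<in>Poly_Mapping.keys q. word_length w = n) \<and>
        a \<notin> order_below n \<and> a \<ominus>\<^bsub>UW\<^esub> UW_class q \<in> order_below n \<and>
        s = symm_of_tensor q)"

definition gr_o :: "'k::field_char_0 tensor set set \<Rightarrow> 'k symm set" where
  "gr_o J = lin_span SW_scalars SW {s. \<exists>a\<in>J. is_leading_symbol a s}"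

end

theory Submission
  imports Defs "HOL-Library.Multiset_Order"
begin

text \<open>
  The degree filtration of the quotient has polynomial growth.  Take \<open>0 \<noteq> x \<in> J\<close>, written in sorted words, and let \<open>r\<close> be the maximal length among its
  words of maximal degree.  Iterated commutators with \<open>r\<close> suitably chosen basis elements \<open>e\<^sub>n\<close>
  turn \<open>x\<close> into an element of \<open>J\<close> whose leading word is an arbitrary prescribed product of \<open>r\<close>
  letters, as long as all of them are at least some constant \<open>C\<close>.  Here words are compared by degree,
  then length, then by the reverse of the multiset order on letters, so that the leading word
  is the one in which the commutators hit the smallest letters and every letter is hit once.
  Hence the elements of degree at most \<open>N\<close> are spanned modulo \<open>J\<close> by the sorted words of
  degree at most \<open>N\<close> with fewer than \<open>r\<close> letters \<open>\<ge> C\<close>, and there are at most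
  \<open>(N + 1) ^ (C + r)\<close> of these.  Only the spanning half of the Poincare-Birkhoff-Witt theorem is used.
\<close>


section \<open>Words in the generators\<close>

instantiation pnat :: linorder
begin

lift_definition less_eq_pnat :: "pnat \<Rightarrow> pnat \<Rightarrow> bool" is "(\<le>)" .

lift_definition less_pnat :: "pnat \<Rightarrow> pnat \<Rightarrow> bool" is "(<)" .

instance
  by standard (transfer; auto)+

end

lemma nat_of_pnat_add [simp]: "nat_of_pnat (i + j) = nat_of_pnat i + nat_of_pnat j"
  by transfer simp

lemma nat_of_pnat_pos [simp]: "0 < nat_of_pnat i"
  by transfer simp

lemma pnat_less_iff: "i < j \<longleftrightarrow> nat_of_pnat i < nat_of_pnat j"
  by transfer simp

lemma pnat_eq_iff: "i = j \<longleftrightarrow> nat_of_pnat i = nat_of_pnat j"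
  by transfer simp

lemma pnat_less_imp_add:
  fixes i j :: pnat
  assumes "i < j"
  obtains n where "j = i + n"
proof -
  have "j = i + pnat_of_nat (nat_of_pnat j - nat_of_pnat i)"
    using assms by (simp add: pnat_eq_iff pnat_less_iff pnat_of_nat_inverse)
  then show thesis
    using that by blast
qed

lemma finite_pnat_le: "finite {i. nat_of_pnat i \<le> N}"
  and card_pnat_le: "card {i. nat_of_pnat i \<le> N} \<le> N"
proof -
  have inj: "inj_on nat_of_pnat {i. nat_of_pnat i \<le> N}"
    by (auto simp: inj_on_def pnat_eq_iff)
  have sub: "nat_of_pnat ` {i. nat_of_pnat i \<le> N} \<subseteq> {1..N}"
    by (auto simp: Suc_le_eq)
  show "finite {i. nat_of_pnat i \<le> N}"
    by (rule inj_on_finite[OF inj sub]) simp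
  show "card {i. nat_of_pnat i \<le> N} \<le> N"
    using card_inj_on_le[OF inj sub] by simp
qed


section \<open>Degree, length and comparison of words\<close>

definition wdeg :: "pnat list \<Rightarrow> nat" where
  "wdeg u = word_degree (Word u)"

lemma wdeg_simps [simp]:
  "wdeg [] = 0" "wdeg (i # u) = nat_of_pnat i + wdeg u" "wdeg (u @ v) = wdeg u + wdeg v"
  by (simp_all add: wdeg_def word_degree_def)

lemma wdeg_mset: "wdeg u = (\<Sum>i\<in>#mset u. nat_of_pnat i)"
  by (simp add: wdeg_def word_degree_def flip: sum_mset_sum_list)

lemma wdeg_eq: "mset u = mset v \<Longrightarrow> wdeg u = wdeg v"
  by (simp add: wdeg_mset)

lemma length_le_wdeg: "length u \<le> wdeg u"
proof (induction u)
  case (Cons i u)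
  then show ?case
    using nat_of_pnat_pos[of i] by (simp del: nat_of_pnat_pos)
qed simp

lemma letter_le_wdeg: "i \<in> set u \<Longrightarrow> nat_of_pnat i \<le> wdeg u"
  by (induction u) auto

lemma finite_wdeg_le: "finite {u. wdeg u \<le> N}"
proof (rule finite_subset)
  show "{u. wdeg u \<le> N} \<subseteq> {u. set u \<subseteq> {i. nat_of_pnat i \<le> N} \<and> length u \<le> N}"
    using length_le_wdeg letter_le_wdeg order_trans by fastforce
  show "finite {u. set u \<subseteq> {i. nat_of_pnat i \<le> N} \<and> length u \<le> N}"
    by (rule finite_lists_length_le[OF finite_pnat_le])
qed

text \<open>Collects the error terms of reordering: each exchange of neighbours \<open>i\<close>,
  \<open>j\<close> leaves a multiple of a word with the single letter \<open>i + j\<close> in their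
  place.\<close>

definition shorter :: "pnat list \<Rightarrow> pnat list set" where
  "shorter u = {v. wdeg v = wdeg u \<and> length v < length u}"

lemma shorter_eq: "mset u = mset v \<Longrightarrow> shorter u = shorter v"
  using wdeg_eq[of u v] mset_eq_length[of u v] by (simp add: shorter_def)

text \<open>A larger multiset counts as lower. \<open>D\<close>, \<open>r\<close> and
  \<open>T\<close> are separate parameters because \<open>T\<close> belongs to the final target,
  while \<open>D\<close> is the degree of the current leading words and still changes.\<close>

definition below :: "nat \<Rightarrow> nat \<Rightarrow> pnat multiset \<Rightarrow> pnat list set" where
  "below D r T = {v. wdeg v < D \<or> wdeg v = D \<and> (length v < r \<or> length v = r \<and> T < mset v)}"

lemma shorter_below: "wdeg u \<le> D \<Longrightarrow> length u \<le> r \<Longrightarrow> shorter u \<subseteq> below D r T"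
  by (auto simp: shorter_def below_def)

lemma wdeg_bump: "k < length u \<Longrightarrow> wdeg (u[k := u ! k + n]) = wdeg u + nat_of_pnat n"
proof (induction u arbitrary: k)
  case (Cons i u)
  then show ?case
    by (cases k) auto
qed simp

lemma pnat_less_add: "(i::pnat) < i + n"
  by (simp add: pnat_less_iff)

lemma bump_greater:
  fixes u :: "pnat list"
  assumes "k < length u"
  shows "mset u < mset (u[k := u ! k + n])"
proof -
  have "{#u ! k#} < {#u ! k + n#}"
    by (rule ex_gt_imp_less_multiset) (simp add: pnat_less_add)
  then have "(mset u - {#u ! k#}) + {#u ! k#} < (mset u - {#u ! k#}) + {#u ! k + n#}"
    by (rule add_strict_left_mono)
  then show ?thesis
    using assms by (simp add: mset_update)
qed

abbreviation sl :: "pnat multiset \<Rightarrow> pnat list" where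
  "sl \<equiv> sorted_list_of_multiset"


section \<open>Monomials of the tensor algebra\<close>

definition term_of :: "'k \<Rightarrow> pnat list \<Rightarrow> 'k::field_char_0 tensor" where
  "term_of c u = Poly_Mapping.single (Word u) c"

lemma term_of_mult [simp]: "term_of c u * term_of d v = term_of (c * d) (u @ v)"
  by (simp add: term_of_def mult_single plus_free_monoid_def)

lemma term_of_0 [simp]: "term_of 0 u = 0"
  by (simp add: term_of_def)

lemma term_of_add: "term_of (c + d) u = term_of c u + term_of d u"
  by (simp add: term_of_def single_add)

lemma one_eq_term_of: "1 = term_of 1 []"
  by (simp add: term_of_def flip: single_one zero_free_monoid_def)

lemma sum_term_of_keys:
  "p = (\<Sum>w\<in>Poly_Mapping.keys p. term_of (Poly_Mapping.lookup p w) (letters w))"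
proof (rule poly_mapping_eqI)
  fix w
  show "Poly_Mapping.lookup p w = Poly_Mapping.lookup
      (\<Sum>w\<in>Poly_Mapping.keys p. term_of (Poly_Mapping.lookup p w) (letters w)) w"
    by (simp add: lookup_sum term_of_def lookup_single when_def in_keys_iff)
qed


section \<open>Two-sided ideals of the tensor algebra containing the Lie relations\<close>

text \<open>Serves both for \<open>lie_ideal\<close> and for the preimage of \<open>J\<close> in the
  tensor algebra, so that rewriting in \<open>UW\<close> and in \<open>UW Quot J\<close> takes place
  among tensors.\<close>

locale lie_congruence =
  fixes I :: "'k::field_char_0 tensor set"
  assumes zero_closed: "0 \<in> I"
    and add_closed: "p \<in> I \<Longrightarrow> q \<in> I \<Longrightarrow> p + q \<in> I"
    and mult_left_closed: "p \<in> I \<Longrightarrow> a * p \<in> I"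
    and mult_right_closed: "p \<in> I \<Longrightarrow> p * a \<in> I"
    and relation: "term_of 1 [i, j] - term_of 1 [j, i]
        - term_of (of_nat (nat_of_pnat j) - of_nat (nat_of_pnat i)) [i + j] \<in> I"
begin

lemma minus_closed: "p \<in> I \<Longrightarrow> - p \<in> I"
  using mult_left_closed[of p "-1"] by simp

lemma diff_closed: "p \<in> I \<Longrightarrow> q \<in> I \<Longrightarrow> p - q \<in> I"
  using add_closed[of p "- q"] minus_closed[of q] by simp

section \<open>Spans of words modulo the ideal\<close>

definition spanned :: "pnat list set \<Rightarrow> 'k tensor set" where
  "spanned A = {p. \<exists>q. p - q \<in> I \<and> (\<forall>w\<in>Poly_Mapping.keys q. letters w \<in> A)}"

lemma spanned_I: "p \<in> I \<Longrightarrow> p \<in> spanned A"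
  unfolding spanned_def by (auto intro!: exI[of _ 0])

lemma spanned_0: "0 \<in> spanned A"
  by (simp add: spanned_I zero_closed)

lemma spanned_mono: "p \<in> spanned A \<Longrightarrow> A \<subseteq> Y \<Longrightarrow> p \<in> spanned Y"
  unfolding spanned_def by blast

lemma spanned_term: "u \<in> A \<Longrightarrow> term_of c u \<in> spanned A"
  unfolding spanned_def by (auto intro!: exI[of _ "term_of c u"] simp: zero_closed term_of_def split: if_splits)

lemma spanned_add:
  assumes "p \<in> spanned A" "q \<in> spanned A"
  shows "p + q \<in> spanned A"
proof -
  obtain p' q' where *: "p - p' \<in> I" "q - q' \<in> I"
    "\<forall>w\<in>Poly_Mapping.keys p'. letters w \<in> A" "\<forall>w\<in>Poly_Mapping.keys q'. letters w \<in> A"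
    using assms unfolding spanned_def by blast
  have "\<forall>w\<in>Poly_Mapping.keys (p' + q'). letters w \<in> A"
    using * keys_add[of p' q'] by blast
  moreover have "(p + q) - (p' + q') \<in> I"
    using add_closed[OF *(1,2)] by (simp add: algebra_simps)
  ultimately show ?thesis
    unfolding spanned_def by blast
qed

lemma spanned_minus: "p \<in> spanned A \<Longrightarrow> - p \<in> spanned A"
proof -
  assume "p \<in> spanned A"
  then obtain q where "p - q \<in> I" "\<forall>w\<in>Poly_Mapping.keys q. letters w \<in> A"
    unfolding spanned_def by blast
  then have "- p - (- q) \<in> I" "\<forall>w\<in>Poly_Mapping.keys (- q). letters w \<in> A"
    using minus_closed[of "p - q"] by (auto simp: in_keys_iff)
  then show ?thesis
    unfolding spanned_def by blast
qed

lemma spanned_diff: "p \<in> spanned A \<Longrightarrow> q \<in> spanned A \<Longrightarrow> p - q \<in> spanned A"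
  using spanned_add[of p A "- q"] spanned_minus[of q A] by simp

lemma spanned_sum: "(\<And>x. x \<in> S \<Longrightarrow> f x \<in> spanned A) \<Longrightarrow> sum f S \<in> spanned A"
  by (induction S rule: infinite_finite_induct) (auto simp: spanned_0 spanned_add)

lemma spanned_cong: "p - q \<in> spanned A \<Longrightarrow> p \<in> spanned A \<longleftrightarrow> q \<in> spanned A"
  using spanned_add[of "p - q" A q] spanned_diff[of p A "p - q"] by auto

lemma spanned_keys: "(\<And>w. w \<in> Poly_Mapping.keys p \<Longrightarrow> letters w \<in> A) \<Longrightarrow> p \<in> spanned A"
  unfolding spanned_def by (auto intro!: exI[of _ p] simp: zero_closed)

text \<open>By additivity \<open>f p\<close> is \<open>f (p - q)\<close>, with \<open>p - q\<close>
  in \<open>I\<close>, plus the values of \<open>f\<close> on the monomials of \<open>q\<close>.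
  Multiplications, commutators and rewriting thus need checking only on \<open>I\<close> and on
  single words.\<close>

lemma spanned_map:
  assumes "p \<in> spanned A"
    and add: "\<And>p q. f (p + q) = f p + f q"
    and I: "\<And>p. p \<in> I \<Longrightarrow> f p \<in> spanned Y"
    and A: "\<And>u c. u \<in> A \<Longrightarrow> f (term_of c u) \<in> spanned Y"
  shows "f p \<in> spanned Y"
proof -
  have f0: "f 0 = 0"
    using add[of 0 0] by simp
  have sum: "f (sum g S) = (\<Sum>x\<in>S. f (g x))" for g and S :: "pnat free_monoid set"
    by (induction S rule: infinite_finite_induct) (auto simp: f0 add)
  obtain q where q: "p - q \<in> I" "\<forall>w\<in>Poly_Mapping.keys q. letters w \<in> A"
    using assms(1) unfolding spanned_def by blast
  have "f q = (\<Sum>w\<in>Poly_Mapping.keys q. f (term_of (Poly_Mapping.lookup q w) (letters w)))"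
    by (subst sum_term_of_keys[of q], rule sum)
  also have "\<dots> \<in> spanned Y"
    by (rule spanned_sum, rule A, use q(2) in blast)
  finally have "f (p - q) + f q \<in> spanned Y"
    using I[OF q(1)] by (rule spanned_add[rotated])
  then show ?thesis
    by (simp flip: add)
qed

lemma spanned_trans:
  assumes "p \<in> spanned A" "\<And>u c. u \<in> A \<Longrightarrow> term_of c u \<in> spanned Y"
  shows "p \<in> spanned Y"
  using spanned_map[of p A "\<lambda>p. p" Y] assms spanned_I by blast

section \<open>Reordering letters\<close>

lemma spanned_mult_shorter:
  assumes "p \<in> spanned (shorter u)"
  shows "term_of c x * p * term_of d y \<in> spanned (shorter (x @ u @ y))"
  using assms
proof (rule spanned_map)
  show "term_of c x * (p + q) * term_of d y
      = term_of c x * p * term_of d y + term_of c x * q * term_of d y" for p q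
    by (simp add: algebra_simps)
  show "p \<in> I \<Longrightarrow> term_of c x * p * term_of d y \<in> spanned (shorter (x @ u @ y))" for p
    by (intro spanned_I mult_left_closed mult_right_closed)
  show "v \<in> shorter u \<Longrightarrow> term_of c x * term_of e v * term_of d y \<in> spanned (shorter (x @ u @ y))" for v e
    by (auto intro!: spanned_term simp: shorter_def)
qed

text \<open>The Lie relation leaves a multiple of \<open>[i + j]\<close>, which has the same degree
  and one letter fewer.\<close>

lemma term_of_swap: "term_of c (x @ [i, j] @ y) - term_of c (x @ [j, i] @ y) \<in> spanned (shorter (x @ [i, j] @ y))"
proof -
  have "term_of 1 [i, j] - term_of 1 [j, i] \<in> spanned (shorter [i, j])"
    unfolding spanned_def using relation[of i j]
    by (auto intro!: exI[of _ "term_of (of_nat (nat_of_pnat j) - of_nat (nat_of_pnat i)) [i + j]"]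
        simp: term_of_def shorter_def split: if_splits)
  from spanned_mult_shorter[OF this, of c x 1 y] show ?thesis
    by (simp add: algebra_simps)
qed

lemma term_of_move: "term_of c (x @ i # v @ y) - term_of c (x @ v @ i # y) \<in> spanned (shorter (x @ i # v @ y))"
proof (induction v arbitrary: x)
  case (Cons j v)
  have "term_of c (x @ i # (j # v) @ y) - term_of c (x @ j # i # v @ y)
      \<in> spanned (shorter (x @ i # (j # v) @ y))"
    using term_of_swap[of c x i j "v @ y"] by simp
  moreover have "term_of c ((x @ [j]) @ i # v @ y) - term_of c ((x @ [j]) @ v @ i # y)
      \<in> spanned (shorter ((x @ [j]) @ i # v @ y))"
    by (rule Cons.IH)
  moreover have "shorter ((x @ [j]) @ i # v @ y) = shorter (x @ i # (j # v) @ y)"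
    by (rule shorter_eq) simp
  ultimately show ?case
    using spanned_add by fastforce
qed (simp add: spanned_0)

text \<open>The first letter of \<open>u\<close> is moved to the front of \<open>v\<close>; what
  follows it agrees up to order and falls to the induction. Every error has the degree of
  \<open>u\<close> and fewer letters.\<close>

lemma term_of_perm: "mset u = mset v \<Longrightarrow> term_of c u - term_of c v \<in> spanned (shorter u)"
proof (induction u arbitrary: c v)
  case (Cons i u)
  then have "i \<in> set v"
    by (metis list.set_intros(1) mset_eq_setD)
  then obtain x y where v: "v = x @ i # y"
    by (meson split_list)
  with Cons.prems have u: "mset u = mset (x @ y)"
    by simp
  from spanned_mult_shorter[OF Cons.IH[OF u, of c], of 1 "[i]" 1 "[]"]
  have "term_of c (i # u) - term_of c (i # x @ y) \<in> spanned (shorter (i # u))"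
    by (simp add: algebra_simps)
  moreover have "term_of c (i # x @ y) - term_of c v \<in> spanned (shorter (i # u))"
    using term_of_move[of c "[]" i x y] shorter_eq[of "i # u" "i # x @ y"] u by (simp add: v)
  ultimately show ?case
    using spanned_add by fastforce
qed (simp add: spanned_0)

lemma term_of_perm_spanned:
  assumes "mset u = mset v" "shorter u \<subseteq> A"
  shows "term_of c u \<in> spanned A \<longleftrightarrow> term_of c v \<in> spanned A"
  by (rule spanned_cong) (rule spanned_mono[OF term_of_perm[OF assms(1)] assms(2)])

text \<open>Spanning half of the Poincare-Birkhoff-Witt theorem: sorting costs only shorter words,
  so induction on the length applies.\<close>

lemma term_of_sorted: "term_of c u \<in> spanned {v. sorted v}"
proof (induction "length u" arbitrary: u c rule: less_induct)
  case less
  have "term_of c u - term_of c (sort u) \<in> spanned (shorter u)"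
    by (rule term_of_perm) simp
  then have "term_of c u - term_of c (sort u) \<in> spanned {v. sorted v}"
    by (rule spanned_trans) (auto intro: less simp: shorter_def)
  then show ?case
    by (simp add: spanned_cong spanned_term)
qed

lemma spanned_sorted: "p \<in> spanned {v. sorted v}"
proof -
  have "p \<in> spanned UNIV"
    by (simp add: spanned_keys)
  then show ?thesis
    by (rule spanned_trans) (rule term_of_sorted)
qed


section \<open>Commutators with a generator\<close>

definition ad :: "pnat \<Rightarrow> 'k tensor \<Rightarrow> 'k tensor" where
  "ad n p = p * term_of 1 [n] - term_of 1 [n] * p"

lemma ad_add: "ad n (p + q) = ad n p + ad n q"
  by (simp add: ad_def algebra_simps)

lemma ad_I: "p \<in> I \<Longrightarrow> ad n p \<in> I"
  unfolding ad_def by (intro diff_closed mult_left_closed mult_right_closed)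

text \<open>The coefficient of \<open>e (i + n)\<close> in the bracket of \<open>e i\<close> with
  \<open>e n\<close>; in characteristic zero it vanishes only for \<open>i = n\<close>.\<close>

definition weight :: "pnat \<Rightarrow> pnat \<Rightarrow> 'k" where
  "weight n i = of_nat (nat_of_pnat n) - of_nat (nat_of_pnat i)"

text \<open>Leibniz rule: the commutator with \<open>e n\<close> is a derivation, and on one letter
  the Lie relation evaluates it. The induction splits off the first letter.\<close>

lemma ad_term_of:
  "ad n (term_of c u) - (\<Sum>k<length u. term_of (c * weight n (u ! k)) (u[k := u ! k + n])) \<in> I"
proof (induction u arbitrary: c)
  case Nil
  show ?case
    by (simp add: ad_def zero_closed)
next
  case (Cons i u)
  let ?r = "term_of 1 [i, n] - term_of 1 [n, i] - term_of (weight n i) [i + n]"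
  let ?s = "ad n (term_of 1 u)
    - (\<Sum>k<length u. term_of (1 * weight n (u ! k)) (u[k := u ! k + n]))"
  have "?r \<in> I"
    using relation[of i n] by (simp add: weight_def)
  then have "term_of c [i] * ?s + ?r * term_of c u \<in> I"
    by (intro add_closed mult_left_closed mult_right_closed Cons.IH)
  also have "term_of c [i] * ?s + ?r * term_of c u = ad n (term_of c (i # u))
    - (\<Sum>k<length (i # u). term_of (c * weight n ((i # u) ! k)) ((i # u)[k := (i # u) ! k + n]))"
    by (simp add: ad_def right_diff_distrib left_diff_distrib sum_distrib_left sum.lessThan_Suc_shift
        mult.commute[of "weight n i" c] del: sum.lessThan_Suc)
  finally show ?case .
qed

text \<open>Raising a letter by \<open>n\<close> shifts all degrees equally, keeps lengths and only
  enlarges the multiset of letters, so lower words stay lower with respect to the same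
  \<open>r\<close> and \<open>T\<close>.\<close>

lemma ad_below:
  assumes "p \<in> spanned (below D r T)"
  shows "ad n p \<in> spanned (below (D + nat_of_pnat n) r T)"
  using assms
proof (rule spanned_map)
  fix u c
  assume u: "u \<in> below D r T"
  have "u[k := u ! k + n] \<in> below (D + nat_of_pnat n) r T" if "k < length u" for k
    using u bump_greater[OF that, of n] unfolding below_def
    by (auto simp: wdeg_bump that)
  then have "(\<Sum>k<length u. term_of (c * weight n (u ! k)) (u[k := u ! k + n]))
      \<in> spanned (below (D + nat_of_pnat n) r T)"
    by (auto intro!: spanned_sum spanned_term)
  then show "ad n (term_of c u) \<in> spanned (below (D + nat_of_pnat n) r T)"
    using spanned_cong[OF spanned_I[OF ad_term_of]] by blast
qed (auto simp: ad_add ad_I spanned_I)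

end


section \<open>Prescribing the leading word\<close>

lemma sum_term_of_const: "(\<Sum>k\<in>K. term_of a v) = term_of (a * of_nat (card K)) v"
  by (induction K rule: infinite_finite_induct) (auto simp: term_of_add algebra_simps)

lemma card_nth_eq: "card {k. k < length u \<and> u ! k = m} = count (mset u) m"
proof -
  have "count (mset u) m = length (filter (\<lambda>i. i = m) u)"
    by (induction u) auto
  then show ?thesis
    by (simp add: length_filter_conv_card)
qed

context lie_congruence
begin

lemma spanned_scale: "p \<in> spanned A \<Longrightarrow> term_of c [] * p \<in> spanned A"
  by (rule spanned_map[of p A "\<lambda>p. term_of c [] * p"])
     (auto intro: spanned_I spanned_term mult_left_closed simp: distrib_left)

lemma spanned_scale_iff: "c \<noteq> 0 \<Longrightarrow> term_of c u \<in> spanned A \<longleftrightarrow> term_of 1 u \<in> spanned A"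
  using spanned_scale[of "term_of c u" A "inverse c"] spanned_scale[of "term_of 1 u" A c] by auto

lemma ad_sum: "ad n (sum f S) = (\<Sum>x\<in>S. ad n (f x))"
  by (induction S rule: infinite_finite_induct) (auto simp: ad_add ad_def[of _ 0])

text \<open>\<open>M\<close> holds the letters still to be raised, \<open>B\<close> the targets
  already produced, \<open>t\<close> the next target and \<open>ts\<close> the later ones. By the
  Leibniz rule each of the \<open>count M m\<close> occurrences of \<open>m\<close> becomes
  \<open>t\<close>. Raising any other letter yields one above \<open>t\<close>, hence a multiset
  above the target and a lower word. If \<open>m\<close> does not occur in \<open>M\<close>, the
  coefficient is zero and only lower words remain.\<close>

lemma ad_leading:
  assumes Mm: "\<And>l. l \<in># M \<Longrightarrow> m \<le> l"
    and mB: "m \<notin> set B"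
    and ts: "\<And>s. s \<in> set ts \<Longrightarrow> s \<le> t"
    and tB: "\<And>b. b \<in> set B \<Longrightarrow> t \<le> b"
    and size: "size M = length (t # ts)"
    and t: "t = m + n"
    and D: "wdeg (sl M @ B) = D"
  shows "ad n (term_of c (sl M @ B))
      - term_of (c * weight n m * of_nat (count M m)) (sl (M - {#m#}) @ t # B)
    \<in> spanned (below (D + nat_of_pnat n) (length (t # ts @ B)) (mset (t # ts @ B)))"
    (is "_ \<in> spanned ?A")
proof -
  define u where "u = sl M @ B"
  define v where "v = sl (M - {#m#}) @ t # B"
  define g where "g k = term_of (c * weight n (u ! k)) (u[k := u ! k + n])" for k
  define K where "K = {k. k < length u \<and> u ! k = m}"
  have len: "length u = length (t # ts @ B)"
    using size by (simp add: u_def flip: size_mset)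
  have mset_u: "mset u = M + mset B"
    by (simp add: u_def)
  have card: "card K = count M m"
    using mB by (simp add: K_def card_nth_eq mset_u count_eq_zero_iff)
  have K: "g k - term_of (c * weight n m) v \<in> spanned ?A" if "k \<in> K" for k
  proof -
    have k: "k < length u" "u ! k = m"
      using that by (auto simp: K_def)
    have "m \<in># mset u"
      using k nth_mem_mset by blast
    then have "m \<in># M"
      using mB by (simp add: mset_u)
    then have "mset (u[k := u ! k + n]) = mset v"
      using k by (simp add: mset_update mset_u v_def t)
    from term_of_perm[OF this] have "g k - term_of (c * weight n m) v \<in> spanned (shorter (u[k := u ! k + n]))"
      by (simp add: g_def k(2))
    then show ?thesis
      by (rule spanned_mono) (rule shorter_below, use k len D in \<open>auto simp: wdeg_bump u_def\<close>)
  qed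
  have nK: "g k \<in> spanned ?A" if k: "k < length u" "u ! k \<noteq> m" for k
  proof -
    define l where "l = u ! k"
    have l: "l \<in># M + mset B" "l \<noteq> m"
      using k nth_mem_mset[OF k(1)] by (auto simp: mset_u l_def)
    have "mset (t # ts @ B) < M + mset B - {#l#} + {#l + n#}"
    proof (cases "l \<in># M")
      case True
      with l Mm[of l] have "m < l"
        by simp
      then have "t < l + n"
        by (simp add: t pnat_less_iff)
      \<comment> \<open>\<open>l + n\<close> exceeds every letter of \<open>t # ts\<close>, and one
        such letter decides the multiset order.\<close>
      then have "mset (t # ts) < M - {#l#} + {#l + n#}"
        using ts by (intro ex_gt_imp_less_multiset exI[of _ "l + n"]) force
      then have "mset (t # ts) + mset B < M - {#l#} + {#l + n#} + mset B"
        by (rule add_strict_right_mono)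
      then show ?thesis
        using True by simp
    next
      case False
      with l have lB: "l \<in># mset B"
        by simp
      then have "t < l + n"
        using tB[of l] pnat_less_add[of l n] by simp
      \<comment> \<open>Here \<open>l\<close> comes from \<open>B\<close>, so the raised letter must
        also outweigh the \<open>l\<close> that it replaces; hence \<open>l\<close> is kept on the
        left.\<close>
      then have "mset (t # ts) + {#l#} < M + {#l + n#}"
        using ts pnat_less_add[of l n]
        by (intro ex_gt_imp_less_multiset exI[of _ "l + n"]) force
      then have "mset (t # ts) + {#l#} + (mset B - {#l#}) < M + {#l + n#} + (mset B - {#l#})"
        by (rule add_strict_right_mono)
      moreover have "mset (t # ts @ B) = mset (t # ts) + {#l#} + (mset B - {#l#})"
        and "M + mset B - {#l#} + {#l + n#} = M + {#l + n#} + (mset B - {#l#})"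
        using lB by simp_all
      ultimately show ?thesis
        by (simp only:)
    qed
    then have "u[k := u ! k + n] \<in> ?A"
      using k(1) len D by (auto simp: below_def wdeg_bump mset_update mset_u l_def u_def)
    then show ?thesis
      unfolding g_def by (rule spanned_term)
  qed
  have "{..<length u} = K \<union> {k. k < length u \<and> u ! k \<noteq> m}"
    by (auto simp: K_def)
  then have "(\<Sum>k<length u. g k) = sum g K + (\<Sum>k | k < length u \<and> u ! k \<noteq> m. g k)"
    by (simp only:) (rule sum.union_disjoint, auto simp: K_def)
  then have "(\<Sum>k<length u. g k) - term_of (c * weight n m * of_nat (count M m)) v
    = (\<Sum>k\<in>K. g k - term_of (c * weight n m) v) + (\<Sum>k | k < length u \<and> u ! k \<noteq> m. g k)"
    by (simp add: sum_subtractf sum_term_of_const card del: sum_constant)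
  also have "\<dots> \<in> spanned ?A"
    by (intro spanned_add spanned_sum K nK) auto
  finally have "(\<Sum>k<length u. g k) - term_of (c * weight n m * of_nat (count M m)) v \<in> spanned ?A" .
  moreover have "ad n (term_of c u) - (\<Sum>k<length u. g k) \<in> spanned ?A"
    unfolding g_def by (rule spanned_I[OF ad_term_of])
  ultimately have "(ad n (term_of c u) - (\<Sum>k<length u. g k)) +
      ((\<Sum>k<length u. g k) - term_of (c * weight n m * of_nat (count M m)) v) \<in> spanned ?A"
    by (rule spanned_add[rotated])
  then show ?thesis
    by (simp add: u_def v_def)
qed

text \<open>
  \<open>B\<close> consists of the target letters already produced.  Each step of the induction on \<open>ts\<close> turns
  the smallest remaining letter of the leading words into the largest remaining target letter;
  every other choice produces a multiset of letters above the target, hence a lower word.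
\<close>

lemma leading_term:
  assumes "x \<in> I" "finite F" "F \<noteq> {}"
    and "\<And>M. M \<in> F \<Longrightarrow> c M \<noteq> 0"
    and "\<And>M. M \<in> F \<Longrightarrow> size M = length ts"
    and "\<And>M. M \<in> F \<Longrightarrow> wdeg (sl M @ B) = D"
    and "\<And>M l s. M \<in> F \<Longrightarrow> l \<in># M \<Longrightarrow> s \<in> set (ts @ B) \<Longrightarrow> 2 * nat_of_pnat l < nat_of_pnat s"
    and "sorted_wrt (\<ge>) ts"
    and "\<And>b s. b \<in> set B \<Longrightarrow> s \<in> set ts \<Longrightarrow> s \<le> b"
    and "x - (\<Sum>M\<in>F. term_of (c M) (sl M @ B)) \<in> spanned (below D (length (ts @ B)) (mset (ts @ B)))"
  shows "term_of 1 (ts @ B) \<in> spanned (below (wdeg (ts @ B)) (length (ts @ B)) (mset (ts @ B)))"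
  using assms
proof (induction ts arbitrary: x F c B D)
  case Nil
  have "F \<subseteq> {{#}}"
    using Nil.prems(5) by auto
  with Nil.prems(3) have F: "F = {{#}}"
    by auto
  have "x - term_of (c {#}) B \<in> spanned (below D (length B) (mset B))"
    using Nil.prems(10) by (simp add: F)
  \<comment> \<open>No letter is left to raise and \<open>x\<close> lies in \<open>I\<close>, so the
    leading monomial itself reduces to lower words; its nonzero coefficient is then divided
    out.\<close>
  from spanned_cong[OF this] have "term_of (c {#}) B \<in> spanned (below D (length B) (mset B))"
    using spanned_I[OF Nil.prems(1)] by simp
  with Nil.prems(4)[of "{#}"] have "term_of 1 B \<in> spanned (below D (length B) (mset B))"
    by (simp add: F spanned_scale_iff[of "c {#}"])
  then show ?case
    using Nil.prems(6)[of "{#}"] by (simp add: F)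
next
  case (Cons t ts)
  define L where "L = (\<Union>M\<in>F. set_mset M)"
  \<comment> \<open>The minimum runs over all of \<open>F\<close>: multisets without
    \<open>m\<close> drop out in this step, and at least one multiset survives.\<close>
  define m where "m = Min L"
  have finL: "finite L"
    using Cons.prems(2) by (simp add: L_def)
  have "L \<noteq> {}"
    using Cons.prems(3,5) by (force simp: L_def)
  with finL have "m \<in> L"
    unfolding m_def by (rule Min_in)
  then obtain M0 where M0: "M0 \<in> F" "m \<in># M0"
    by (auto simp: L_def)
  have m_le: "m \<le> l" if "M \<in> F" "l \<in># M" for M l
    unfolding m_def using that finL by (intro Min_le) (auto simp: L_def)
  have lt: "l < s" if "M \<in> F" "l \<in># M" "s \<in> set ((t # ts) @ B)" for M l s
    using Cons.prems(7)[OF that] by (simp add: pnat_less_iff)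
  have mt: "2 * nat_of_pnat m < nat_of_pnat t"
    using Cons.prems(7)[OF M0, of t] by simp
  then have "m < t"
    by (simp add: pnat_less_iff)
  then obtain n where t: "t = m + n"
    by (rule pnat_less_imp_add)
  \<comment> \<open>From \<open>t = m + n\<close> and \<open>2 m < t\<close> follows
    \<open>n > m\<close>; this is the purpose of the factor 2 in the hypothesis on the
    letters.\<close>
  have w0: "weight n m \<noteq> 0"
    using mt by (simp add: weight_def t)
  define T where "T = mset ((t # ts) @ B)"
  define r where "r = length ((t # ts) @ B)"
  define A where "A = below (D + nat_of_pnat n) r T"
  define g where "g M = term_of (c M * weight n m * of_nat (count M m)) (sl (M - {#m#}) @ t # B)" for M
  define F' where "F' = (\<lambda>M. M - {#m#}) ` {M \<in> F. m \<in># M}"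
  define c' where "c' N = c (add_mset m N) * weight n m * of_nat (count (add_mset m N) m)" for N
  have lead: "ad n (term_of (c M) (sl M @ B)) - g M \<in> spanned A" if M: "M \<in> F" for M
    unfolding g_def A_def r_def T_def append_Cons
  proof (rule ad_leading[where ts = ts and t = t])
    show "m \<notin> set B"
      using lt[OF M0, of m] by auto
  qed (use M lt m_le t Cons.prems(5,6,8,9) in auto)
  have "ad n x - (\<Sum>M\<in>F. g M) = ad n (x - (\<Sum>M\<in>F. term_of (c M) (sl M @ B)))
    + (\<Sum>M\<in>F. ad n (term_of (c M) (sl M @ B)) - g M)"
    using ad_add[of n "x - (\<Sum>M\<in>F. term_of (c M) (sl M @ B))" "\<Sum>M\<in>F. term_of (c M) (sl M @ B)"]
    by (simp add: ad_sum sum_subtractf)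
  moreover have "\<dots> \<in> spanned A"
    unfolding A_def
    by (intro spanned_add spanned_sum ad_below lead[unfolded A_def])
       (use Cons.prems(10) in \<open>simp_all add: r_def T_def\<close>)
  moreover have "(\<Sum>M\<in>F. g M) = (\<Sum>M | M \<in> F \<and> m \<in># M. g M)"
    using Cons.prems(2) by (intro sum.mono_neutral_right) (auto simp: g_def not_in_iff)
  \<comment> \<open>Removing one \<open>m\<close> is injective on the multisets that contain it, so
    no two leading words merge and no coefficients cancel.\<close>
  moreover have "\<dots> = (\<Sum>N\<in>F'. term_of (c' N) (sl N @ t # B))"
    unfolding F'_def by (subst sum.reindex) (auto simp: inj_on_def g_def c'_def, metis insert_DiffM)
  ultimately have *: "ad n x - (\<Sum>N\<in>F'. term_of (c' N) (sl N @ t # B)) \<in> spanned A"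
    by (simp only:)
  have F': "add_mset m N \<in> F" if "N \<in> F'" for N
    using that by (auto simp: F'_def)
  \<comment> \<open>\<open>t\<close> has passed from the pending targets to \<open>B\<close>; the
    target word is only permuted, which leaves the set of lower words unchanged.\<close>
  have "term_of 1 (ts @ t # B) \<in> spanned (below (wdeg (ts @ t # B)) (length (ts @ t # B)) (mset (ts @ t # B)))"
  proof (rule Cons.IH)
    show "ad n x \<in> I"
      by (rule ad_I[OF Cons.prems(1)])
    show "finite F'" "F' \<noteq> {}"
      using Cons.prems(2) M0 by (auto simp: F'_def)
    \<comment> \<open>Characteristic zero keeps the multiplicity of \<open>m\<close> nonzero in the
      field.\<close>
    show "c' N \<noteq> 0" if "N \<in> F'" for N
      using Cons.prems(4)[OF F'[OF that]] w0 by (simp add: c'_def del: of_nat_Suc)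
    show "size N = length ts" if "N \<in> F'" for N
      using Cons.prems(5)[OF F'[OF that]] by simp
    show "wdeg (sl N @ t # B) = D + nat_of_pnat n" if "N \<in> F'" for N
      using Cons.prems(6)[OF F'[OF that]] by (simp add: wdeg_mset t)
    show "2 * nat_of_pnat l < nat_of_pnat s"
      if "N \<in> F'" "l \<in># N" "s \<in> set (ts @ t # B)" for N l s
      using Cons.prems(7)[OF F'[OF that(1)], of l s] that by auto
    show "sorted_wrt (\<ge>) ts" "\<And>b s. b \<in> set (t # B) \<Longrightarrow> s \<in> set ts \<Longrightarrow> s \<le> b"
      using Cons.prems(8,9) by auto
    show "ad n x - (\<Sum>N\<in>F'. term_of (c' N) (sl N @ t # B))
        \<in> spanned (below (D + nat_of_pnat n) (length (ts @ t # B)) (mset (ts @ t # B)))"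
      using * by (simp add: A_def r_def T_def)
  qed
  moreover have "below (wdeg (ts @ t # B)) (length (ts @ t # B)) (mset (ts @ t # B))
      = below (wdeg ((t # ts) @ B)) (length ((t # ts) @ B)) (mset ((t # ts) @ B))" (is "_ = ?C")
    by (simp add: add.left_commute)
  ultimately have "term_of 1 (ts @ t # B) \<in> spanned ?C"
    by (simp only:)
  moreover have "mset ((t # ts) @ B) = mset (ts @ t # B)"
    by simp
  ultimately show ?case
    using term_of_perm_spanned[OF _ shorter_below[OF order_refl order_refl]] by blast
qed

end


section \<open>Irreducible words\<close>

text \<open>The words that escape reduction, once products of \<open>r\<close> letters that are all
  at least \<open>C\<close> can be rewritten by lower words.\<close>

definition irreducible_words :: "nat \<Rightarrow> nat \<Rightarrow> pnat list set" where
  "irreducible_words C r = {u. sorted u \<and> length (filter (\<lambda>i. C \<le> nat_of_pnat i) u) < r}"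

text \<open>A sorted list is determined by the multiplicities of its letters, which lie between 0
  and \<open>N\<close>.\<close>

lemma card_sorted_lists_le:
  assumes "finite S"
  shows "finite {v. sorted v \<and> set v \<subseteq> S \<and> length v \<le> N}"
    and "card {v. sorted v \<and> set v \<subseteq> S \<and> length v \<le> N} \<le> (N + 1) ^ card S"
proof -
  let ?A = "{v. sorted v \<and> set v \<subseteq> S \<and> length v \<le> N}"
  let ?f = "\<lambda>v. restrict (count (mset v)) S"
  have inj: "inj_on ?f ?A"
  proof (rule inj_onI)
    fix v w
    assume v: "v \<in> ?A" and w: "w \<in> ?A" and eq: "?f v = ?f w"
    have "count (mset v) i = count (mset w) i" for i
    proof (cases "i \<in> S")
      case True
      then show ?thesis
        using fun_cong[OF eq, of i] by simp
    next
      case False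
      then have "i \<notin> set v" "i \<notin> set w"
        using v w by auto
      then show ?thesis
        by (simp add: count_list_0_iff count_mset)
    qed
    then have "mset v = mset w"
      by (rule multiset_eqI)
    then show "v = w"
      using v w properties_for_sort[of w v] by (auto simp: sorted_sort_id)
  qed
  have sub: "?f ` ?A \<subseteq> S \<rightarrow>\<^sub>E {..N}"
  proof
    fix g
    assume "g \<in> ?f ` ?A"
    then obtain v where v: "g = ?f v" "length v \<le> N"
      by blast
    have "count (mset v) i \<le> N" for i
      using count_le_size[of "mset v" i] v(2) by simp
    then show "g \<in> S \<rightarrow>\<^sub>E {..N}"
      by (simp add: v(1))
  qed
  have fin: "finite (S \<rightarrow>\<^sub>E {..N})"
    using assms by (intro finite_PiE) auto
  show "finite ?A"
    by (rule inj_on_finite[OF inj sub fin])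
  show "card ?A \<le> (N + 1) ^ card S"
    using card_inj_on_le[OF inj sub fin] assms by (simp add: card_PiE)
qed

lemma sum_powers_le: "(\<Sum>i\<le>r. N ^ i) \<le> (N + 1) ^ r" for N :: nat
proof (induction r)
  case (Suc r)
  have "N * N ^ r \<le> N * (N + 1) ^ r"
    by (intro mult_left_mono power_mono) auto
  with Suc have "(\<Sum>i\<le>r. N ^ i) + N * N ^ r \<le> (N + 1) ^ r + N * (N + 1) ^ r"
    by (rule add_mono)
  then show ?case
    by simp
qed simp

text \<open>A word splits into its letters below \<open>C\<close> and the rest; lengths and letters
  are at most \<open>N\<close>. The first part is sorted with at most \<open>C\<close> kinds of
  letters, giving \<open>(N + 1) ^ C\<close>; the second is a list of at most \<open>r\<close>
  letters out of at most \<open>N\<close>, giving \<open>(N + 1) ^ r\<close>.\<close>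

lemma card_irreducible_words_le:
  shows "finite {u \<in> irreducible_words C r. wdeg u \<le> N}"
    and "card {u \<in> irreducible_words C r. wdeg u \<le> N} \<le> (N + 1) ^ (C + r)"
proof -
  let ?A = "{u \<in> irreducible_words C r. wdeg u \<le> N}"
  let ?S = "{i. nat_of_pnat i \<le> C}" and ?L = "{i. nat_of_pnat i \<le> N}"
  let ?P = "{v. sorted v \<and> set v \<subseteq> ?S \<and> length v \<le> N}"
  let ?Q = "{v. set v \<subseteq> ?L \<and> length v \<le> r}"
  let ?f = "\<lambda>u. (filter (\<lambda>i. \<not> C \<le> nat_of_pnat i) u, filter (\<lambda>i. C \<le> nat_of_pnat i) u)"
  have inj: "inj_on ?f ?A"
  proof (rule inj_onI)
    fix u v
    assume u: "u \<in> ?A" and v: "v \<in> ?A" and eq: "?f u = ?f v"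
    have "mset w = mset (fst (?f w)) + mset (snd (?f w))" for w
      by simp
    with eq have "mset u = mset v"
      by metis
    then show "u = v"
      using u v properties_for_sort[of u v] by (auto simp: irreducible_words_def sorted_sort_id)
  qed
  have sub: "?f ` ?A \<subseteq> ?P \<times> ?Q"
  proof
    fix y
    assume "y \<in> ?f ` ?A"
    then obtain u where u: "u \<in> ?A" "y = ?f u"
      by blast
    have "length (filter (\<lambda>i. \<not> C \<le> nat_of_pnat i) u) \<le> N"
      using u(1) length_le_wdeg[of u] by (auto intro: order_trans[OF length_filter_le])
    then show "y \<in> ?P \<times> ?Q"
      using u by (auto simp: irreducible_words_def sorted_filter[of id, simplified] dest: letter_le_wdeg)
  qed
  have fin: "finite (?P \<times> ?Q)"
    by (intro finite_cartesian_product card_sorted_lists_le finite_lists_length_le finite_pnat_le)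
  show "finite ?A"
    by (rule inj_on_finite[OF inj sub fin])
  have "card ?P \<le> (N + 1) ^ card ?S"
    by (rule card_sorted_lists_le[OF finite_pnat_le])
  also have "\<dots> \<le> (N + 1) ^ C"
    by (rule power_increasing[OF card_pnat_le]) simp
  finally have P: "card ?P \<le> (N + 1) ^ C" .
  have "card ?Q = (\<Sum>i\<le>r. card ?L ^ i)"
    by (rule card_lists_length_le[OF finite_pnat_le])
  also have "\<dots> \<le> (\<Sum>i\<le>r. N ^ i)"
    by (intro sum_mono power_mono card_pnat_le) simp
  also have "\<dots> \<le> (N + 1) ^ r"
    by (rule sum_powers_le)
  finally have "card (?P \<times> ?Q) \<le> (N + 1) ^ (C + r)"
    using P by (simp add: card_cartesian_product power_add mult_mono)
  then show "card ?A \<le> (N + 1) ^ (C + r)"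
    using card_inj_on_le[OF inj sub fin] by simp
qed

section \<open>Reduction to irreducible words\<close>

abbreviation below_word :: "pnat list \<Rightarrow> pnat list set" where
  "below_word u \<equiv> below (wdeg u) (length u) (mset u)"

lemma finite_below_word: "finite (below_word u)"
  by (rule finite_subset[OF _ finite_wdeg_le[of "wdeg u"]]) (auto simp: below_def)

text \<open>Strict because \<open>v\<close> lies below \<open>u\<close> but not below itself; this
  makes \<open>card (below_word u)\<close> a termination measure for the reduction.\<close>

lemma below_word_psubset: "v \<in> below_word u \<Longrightarrow> below_word v \<subset> below_word u"
  by (rule psubsetI) (auto simp: below_def)

context lie_congruence
begin

text \<open>\<open>D\<close> is the top degree of \<open>x\<close> and \<open>r\<close> the greatest
  length in that degree. The words attaining both lead; all others are lower for every
  target.\<close>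

lemma exists_leading_term:
  assumes x: "x \<in> I" "x \<noteq> 0" and sorted: "\<And>w. w \<in> Poly_Mapping.keys x \<Longrightarrow> sorted (letters w)"
  obtains C r where
    "\<And>ts. sorted_wrt (\<ge>) ts \<Longrightarrow> length ts = r \<Longrightarrow> (\<And>s. s \<in> set ts \<Longrightarrow> C \<le> nat_of_pnat s)
      \<Longrightarrow> term_of 1 ts \<in> spanned (below_word ts)"
proof -
  define K where "K = Poly_Mapping.keys x"
  define D where "D = Max ((\<lambda>w. wdeg (letters w)) ` K)"
  define K1 where "K1 = {w \<in> K. wdeg (letters w) = D}"
  define r where "r = Max ((\<lambda>w. length (letters w)) ` K1)"
  define K2 where "K2 = {w \<in> K1. length (letters w) = r}"
  define F where "F = (\<lambda>w. mset (letters w)) ` K2"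
  define c where "c M = Poly_Mapping.lookup x (Word (sl M))" for M
  have fin: "finite K" "finite K1" "finite K2"
    by (simp_all add: K_def K1_def K2_def)
  have "K \<noteq> {}"
    using x(2) by (simp add: K_def)
  then have "D \<in> (\<lambda>w. wdeg (letters w)) ` K"
    unfolding D_def using fin by (intro Max_in) auto
  then have "K1 \<noteq> {}"
    by (auto simp: K1_def)
  then have "r \<in> (\<lambda>w. length (letters w)) ` K1"
    unfolding r_def using fin by (intro Max_in) auto
  then have "K2 \<noteq> {}"
    by (auto simp: K2_def)
  have leD: "wdeg (letters w) \<le> D" if "w \<in> K" for w
    unfolding D_def using fin that by (intro Max_ge) auto
  have ler: "length (letters w) \<le> r" if "w \<in> K1" for w
    unfolding r_def using fin that by (intro Max_ge) auto
  have sl: "sl (mset (letters w)) = letters w" if "w \<in> K2" for w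
    using that sorted[of w] by (simp add: K_def K1_def K2_def sorted_sort_id)
  show thesis
  \<comment> \<open>Letters of a word of degree \<open>D\<close> are at most \<open>D\<close>, so
    the threshold \<open>2 * D + 1\<close> makes every target letter more than twice as
    large.\<close>
  proof (rule that[of r "2 * D + 1"])
    fix ts
    assume ts: "sorted_wrt (\<ge>) ts" "length ts = r" "\<And>s. s \<in> set ts \<Longrightarrow> 2 * D + 1 \<le> nat_of_pnat s"
    have "x - (\<Sum>M\<in>F. term_of (c M) (sl M)) = (\<Sum>w\<in>K. term_of (Poly_Mapping.lookup x w) (letters w))
      - (\<Sum>w\<in>K2. term_of (Poly_Mapping.lookup x w) (letters w))"
    proof (intro arg_cong2[where f = "(-)"])
      show "x = (\<Sum>w\<in>K. term_of (Poly_Mapping.lookup x w) (letters w))"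
        unfolding K_def by (rule sum_term_of_keys)
      \<comment> \<open>Sortedness recovers a leading word from its multiset, so distinct words keep
        distinct indices in \<open>F\<close>.\<close>
      have "inj_on (\<lambda>w. mset (letters w)) K2"
        by (rule inj_on_inverseI[of _ "\<lambda>M. Word (sl M)"]) (simp add: sl del: sorted_list_of_multiset_mset)
      then show "(\<Sum>M\<in>F. term_of (c M) (sl M))
          = (\<Sum>w\<in>K2. term_of (Poly_Mapping.lookup x w) (letters w))"
        unfolding F_def
        by (subst sum.reindex) (simp_all add: c_def sl del: sorted_list_of_multiset_mset cong: sum.cong)
    qed
    also have "\<dots> = (\<Sum>w\<in>K - K2. term_of (Poly_Mapping.lookup x w) (letters w))"
      by (rule sum_diff[symmetric, OF fin(1)]) (auto simp: K1_def K2_def)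
    finally have "x - (\<Sum>M\<in>F. term_of (c M) (sl M))
      = (\<Sum>w\<in>K - K2. term_of (Poly_Mapping.lookup x w) (letters w))" .
    moreover have "letters w \<in> below D r (mset ts)" if "w \<in> K - K2" for w
      using that leD[of w] ler[of w] by (auto simp: below_def K1_def K2_def)
    ultimately have lower: "x - (\<Sum>M\<in>F. term_of (c M) (sl M)) \<in> spanned (below D r (mset ts))"
      by (auto intro!: spanned_sum spanned_term)
    have "term_of 1 (ts @ []) \<in> spanned (below_word (ts @ []))"
    proof (rule leading_term)
      show "x \<in> I"
        by (rule x(1))
      show "finite F" "F \<noteq> {}"
        using fin \<open>K2 \<noteq> {}\<close> by (simp_all add: F_def)
      show "c M \<noteq> 0" if "M \<in> F" for M
      proof -
        obtain w where w: "w \<in> K2" "M = mset (letters w)"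
          using \<open>M \<in> F\<close> by (auto simp: F_def)
        then have "c M = Poly_Mapping.lookup x w"
          by (simp add: c_def sl del: sorted_list_of_multiset_mset)
        then show ?thesis
          using w(1) by (simp add: K2_def K1_def K_def in_keys_iff)
      qed
      show "size M = length ts" if "M \<in> F" for M
        using that by (auto simp: F_def K2_def ts(2))
      show "wdeg (sl M @ []) = D" if "M \<in> F" for M
        using that by (auto simp: F_def K2_def K1_def wdeg_mset)
      show "2 * nat_of_pnat l < nat_of_pnat s" if "M \<in> F" "l \<in># M" "s \<in> set (ts @ [])" for M l s
      proof -
        have "nat_of_pnat l \<le> D"
          using that letter_le_wdeg[of l] by (auto simp: F_def K2_def K1_def)
        then show ?thesis
          using ts(3)[of s] that by simp
      qed
      show "x - (\<Sum>M\<in>F. term_of (c M) (sl M @ [])) \<in> spanned (below D (length (ts @ [])) (mset (ts @ [])))"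
        using lower by (simp add: ts(2))
    qed (use ts in auto)
    then show "term_of 1 ts \<in> spanned (below_word ts)"
      by simp
  qed
qed

text \<open>Appending \<open>y\<close> adds the same degree, length and letters to both words, and
  the multiset order is compatible with sums.\<close>

lemma spanned_below_mult:
  assumes "term_of 1 u \<in> spanned (below_word u)"
  shows "term_of c (u @ y) \<in> spanned (below_word (u @ y))"
proof -
  have "term_of 1 u * term_of c y \<in> spanned (below_word (u @ y))"
    using assms
  proof (rule spanned_map)
    fix v d
    assume "v \<in> below_word u"
    then have "v @ y \<in> below_word (u @ y)"
      by (auto simp: below_def)
    then show "term_of d v * term_of c y \<in> spanned (below_word (u @ y))"
      by (simp add: spanned_term)
  qed (auto simp: distrib_right intro: spanned_I mult_right_closed)
  then show ?thesis
    by simp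
qed

text \<open>If at least \<open>r\<close> letters of \<open>u\<close> are at least \<open>C\<close>,
  then \<open>r\<close> of them are moved to the front and rewritten by \<open>lead\<close>;
  otherwise sorting \<open>u\<close> gives an irreducible word. In both cases what remains is lower
  and falls to the induction.\<close>

lemma term_of_irreducible:
  assumes lead: "\<And>ts. sorted_wrt (\<ge>) ts \<Longrightarrow> length ts = r \<Longrightarrow> (\<And>s. s \<in> set ts \<Longrightarrow> C \<le> nat_of_pnat s)
      \<Longrightarrow> term_of 1 ts \<in> spanned (below_word ts)"
  shows "term_of c u \<in> spanned {v \<in> irreducible_words C r. wdeg v \<le> wdeg u}"
proof (induction "card (below_word u)" arbitrary: u c rule: less_induct)
  case less
  let ?A = "{v \<in> irreducible_words C r. wdeg v \<le> wdeg u}"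
  have below: "p \<in> spanned ?A" if "p \<in> spanned (below_word u)" for p
    using that
  proof (rule spanned_trans)
    fix v d
    assume v: "v \<in> below_word u"
    have "card (below_word v) < card (below_word u)"
      by (rule psubset_card_mono[OF finite_below_word below_word_psubset[OF v]])
    from less[OF this, of d] have "term_of d v \<in> spanned {w \<in> irreducible_words C r. wdeg w \<le> wdeg v}" .
    then show "term_of d v \<in> spanned ?A"
      by (rule spanned_mono) (use v in \<open>auto simp: below_def\<close>)
  qed
  have shorter: "shorter u \<subseteq> below_word u"
    by (rule shorter_below) simp_all
  \<comment> \<open>Decreasing order gives the first \<open>r\<close> large letters the shape that
    \<open>lead\<close> requires.\<close>
  define ls where "ls = filter (\<lambda>i. C \<le> nat_of_pnat i) (rev (sort u))"
  show ?case
  proof (cases "r \<le> length ls")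
    case True
    define ts where "ts = take r ls"
    have "sorted_wrt (\<ge>) (rev (sort u))"
      by (simp add: sorted_wrt_rev)
    then have "sorted_wrt (\<ge>) ts"
      unfolding ts_def ls_def by (intro sorted_wrt_take sorted_wrt_filter)
    moreover have "length ts = r"
      using True by (simp add: ts_def)
    moreover have "C \<le> nat_of_pnat s" if "s \<in> set ts" for s
      using that in_set_takeD[of s r ls] by (auto simp: ts_def ls_def)
    ultimately have ts: "term_of 1 ts \<in> spanned (below_word ts)"
      by (rule lead)
    have "mset ts \<subseteq># mset ls"
      unfolding ts_def by (metis append_take_drop_id mset_append mset_subset_eq_add_left)
    also have "mset ls \<subseteq># mset u"
      by (simp add: ls_def)
    finally have mset: "mset u = mset (ts @ sl (mset u - mset ts))" (is "_ = mset ?v")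
      by simp
    have "term_of c ?v \<in> spanned (below_word ?v)"
      by (rule spanned_below_mult[OF ts])
    moreover have "below_word ?v = below_word u"
      using mset wdeg_eq[OF mset] mset_eq_length[OF mset] by simp
    ultimately have "term_of c ?v \<in> spanned (below_word u)"
      by (simp only:)
    then show ?thesis
      by (intro below iffD2[OF term_of_perm_spanned[OF mset shorter]])
  next
    case False
    have "length ls = length (filter (\<lambda>i. C \<le> nat_of_pnat i) (sort u))"
      by (simp add: ls_def flip: rev_filter)
    with False have "sort u \<in> ?A"
      using wdeg_eq[of "sort u" u] by (simp add: irreducible_words_def)
    then have "term_of c (sort u) \<in> spanned ?A"
      by (rule spanned_term)
    moreover have "term_of c u - term_of c (sort u) \<in> spanned ?A"
      by (intro below spanned_mono[OF term_of_perm shorter]) simp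
    ultimately show ?thesis
      by (simp only: spanned_cong)
  qed
qed

lemma spanned_by_irreducible:
  assumes x: "x \<in> I" "x \<noteq> 0" and sorted: "\<And>w. w \<in> Poly_Mapping.keys x \<Longrightarrow> sorted (letters w)"
  obtains C r where
    "\<And>p N. (\<And>w. w \<in> Poly_Mapping.keys p \<Longrightarrow> wdeg (letters w) \<le> N)
      \<Longrightarrow> p \<in> spanned {v \<in> irreducible_words C r. wdeg v \<le> N}"
proof -
  obtain C r where
    lead: "\<And>ts. sorted_wrt (\<ge>) ts \<Longrightarrow> length ts = r \<Longrightarrow> (\<And>s. s \<in> set ts \<Longrightarrow> C \<le> nat_of_pnat s)
      \<Longrightarrow> term_of 1 ts \<in> spanned (below_word ts)"
    using exists_leading_term[OF assms] by blast
  have "p \<in> spanned {v \<in> irreducible_words C r. wdeg v \<le> N}"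
    if "\<And>w. w \<in> Poly_Mapping.keys p \<Longrightarrow> wdeg (letters w) \<le> N" for p N
  proof (rule spanned_trans)
    show "p \<in> spanned {u. wdeg u \<le> N}"
      using that by (intro spanned_keys) simp
    fix c u
    assume u: "u \<in> {u. wdeg u \<le> N}"
    have "term_of c u \<in> spanned {v \<in> irreducible_words C r. wdeg v \<le> wdeg u}"
      by (rule term_of_irreducible) (rule lead)
    then show "term_of c u \<in> spanned {v \<in> irreducible_words C r. wdeg v \<le> N}"
      by (rule spanned_mono) (use u in auto)
  qed
  with that show thesis
    by blast
qed

end


section \<open>Filtrations and Gelfand-Kirillov dimension\<close>

text \<open>Discarding each vector that lies in the span of its successors leaves an independent
  list with the same span, and no independent list inside that span is longer.\<close>

lemma (in ring) dim_le_length: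
  assumes K: "subfield K R" and V: "subalgebra K V R"
    and Us: "set Us \<subseteq> carrier R" "V \<subseteq> Span K Us"
  shows "dim K V \<le> length Us"
proof -
  have "\<exists>Ws. independent K Ws \<and> Span K Ws = Span K Us \<and> length Ws \<le> length Us"
    using Us(1)
  proof (induction Us)
    case Nil
    then show ?case
      by auto
  next
    case (Cons u Us)
    then obtain Ws where Ws: "independent K Ws" "Span K Ws = Span K Us" "length Ws \<le> length Us"
      by auto
    show ?case
    proof (cases "u \<in> Span K Us")
      case True
      then have "Span K (u # Us) = Span K Us"
        using Span_base_incl[OF K] mono_Span_subset[OF K] Cons.prems
        by (metis insert_subset list.simps(15) subset_antisym)
      with Ws show ?thesis
        by auto
    next
      case False
      with Ws Cons.prems have "independent K (u # Ws)"
        by (simp add: li_Cons)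
      with Ws show ?thesis
        by (intro exI[of _ "u # Ws"]) simp
    qed
  qed
  then obtain Ws where Ws: "independent K Ws" "Span K Ws = Span K Us" "length Ws \<le> length Us"
    by blast
  have "finite_dimension K V"
    using Span_finite_dimension[OF K Us(1)] V Us(2) by (rule subalbegra_incl_imp_finite_dimension[OF K])
  from finite_dimensionE[OF K this] have "dimension (dim K V) K V"
    by (simp add: over_def)
  then obtain Vs where Vs: "independent K Vs" "length Vs = dim K V" "Span K Vs = V" "set Vs \<subseteq> carrier R"
    using exists_base[OF K] by blast
  have "set Vs \<subseteq> Span K Ws"
    using Span_base_incl[OF K Vs(4)] Vs(3) Us(2) Ws(2) by auto
  from independent_length_le[OF K Vs(1) Ws(1) this] show ?thesis
    using Vs(2) Ws(3) by simp
qed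

lemma (in ring) lin_span_min: "subalgebra K V R \<Longrightarrow> S \<subseteq> V \<Longrightarrow> lin_span K R S \<subseteq> V"
  unfolding lin_span_def by blast

lemma (in ring) lin_span_subalgebra:
  assumes "K \<subseteq> carrier R" "S \<subseteq> carrier R"
  shows "subalgebra K (lin_span K R S) R"
proof -
  let ?A = "{V. subalgebra K V R \<and> S \<subseteq> V}"
  have "carrier R \<in> ?A"
    using carrier_is_subalgebra[OF assms(1)] assms(2) by simp
  then have "subgroup (\<Inter>?A) (add_monoid R)"
    by (intro add.subgroups_Inter) (auto simp: subalgebra_def)
  then show ?thesis
    unfolding lin_span_def subalgebra_def subalgebra_axioms_def by auto
qed

section \<open>Polynomial growth of a filtration\<close>

text \<open>For \<open>n >= m + 2\<close> the constant \<open>m\<close> is absorbed by a further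
  factor \<open>n\<close>, as \<open>m * n + 1 <= n ^ 2\<close>; this doubles the exponent but makes
  the bound independent of \<open>m\<close>.\<close>

lemma ereal_log_le:
  assumes "d \<le> (m * n + 1) ^ e" "m + 2 \<le> n"
  shows "ereal_log n d \<le> ereal (2 * real e)"
proof (cases "d = 0")
  case False
  have "m * n + 1 \<le> (m + 1) * n"
    using assms(2) by simp
  also have "\<dots> \<le> n * n"
    using assms(2) by (intro mult_right_mono) auto
  finally have "(m * n + 1) ^ e \<le> (n ^ 2) ^ e"
    by (intro power_mono) (simp_all add: power2_eq_square)
  with assms(1) have "d \<le> n ^ (2 * e)"
    by (simp add: power_mult)
  then have "real d \<le> real n ^ (2 * e)"
    by (metis of_nat_le_iff of_nat_power)
  then have "log (real n) (real d) \<le> log (real n) (real n ^ (2 * e))"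
    using False assms(2) by (intro log_mono) auto
  then show ?thesis
    using False assms(2) by (simp add: ereal_log_def log_nat_power)
qed (simp add: ereal_log_def)

text \<open>A finite-dimensional \<open>V\<close> lies in some \<open>F m\<close>, so its powers up
  to the \<open>n\<close>-th lie in \<open>F (m * n)\<close>, whose dimension is at most
  \<open>(m * n + 1) ^ e\<close>. Only \<open>m\<close> depends on \<open>V\<close>, and the
  resulting bound does not involve \<open>m\<close>.\<close>

lemma (in ring) GKdim_filtration_le:
  assumes K: "subfield K R"
    and sub: "\<And>N. subalgebra K (F N) R"
    and mono: "\<And>M N. M \<le> N \<Longrightarrow> F M \<subseteq> F N"
    and scalars: "K \<subseteq> F 0"
    and mult: "\<And>M N x y. x \<in> F M \<Longrightarrow> y \<in> F N \<Longrightarrow> x \<otimes> y \<in> F (M + N)"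
    and exhaust: "carrier R \<subseteq> (\<Union>N. F N)"
    and growth: "\<And>N. \<exists>Us. set Us \<subseteq> carrier R \<and> F N \<subseteq> Span K Us \<and> length Us \<le> (N + 1) ^ e"
  shows "GKdim K R \<le> ereal (2 * real e)"
  unfolding GKdim_def
proof (rule SUP_least, clarify)
  fix V
  assume V: "subalgebra K V R" "finite_dimension K V"
  obtain Vs where Vs: "set Vs \<subseteq> carrier R" "Span K Vs = V"
    using V(2) exists_base[OF K] unfolding finite_dimension_def by blast
  have "\<exists>m. set Vs \<subseteq> F m"
    using Vs(1)
  proof (induction Vs)
    case (Cons v Vs)
    then obtain m k where "set Vs \<subseteq> F m" "v \<in> F k"
      using exhaust by fastforce
    then have "set (v # Vs) \<subseteq> F (max m k)"
      using mono[of m "max m k"] mono[of k "max m k"] by auto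
    then show ?case
      by blast
  qed simp
  then obtain m where "set Vs \<subseteq> F m"
    by blast
  then have Vm: "V \<subseteq> F m"
    using subalgebra_Span_incl[OF K sub[of m]] Vs(2) by blast
  have power: "space_power K R V k \<subseteq> F (m * k)" for k
  proof (induction k)
    case 0
    then show ?case
      using scalars by simp
  next
    case (Suc k)
    have "x \<otimes> y \<in> F (m * Suc k)" if "x \<in> space_power K R V k" "y \<in> V" for x y
      using mult[of x "m * k" y m] Suc Vm that by (auto simp: add.commute)
    then have "{x \<otimes> y |x y. x \<in> space_power K R V k \<and> y \<in> V} \<subseteq> F (m * Suc k)"
      by blast
    then show ?case
      unfolding space_power.simps by (rule lin_span_min[OF sub])
  qed
  have "dim K (lin_span K R (\<Union>k\<le>n. space_power K R V k)) \<le> (m * n + 1) ^ e" for n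
  proof -
    let ?S = "\<Union>k\<le>n. space_power K R V k"
    have S: "?S \<subseteq> F (m * n)"
    proof (intro UN_least)
      fix k assume "k \<in> {..n}"
      then show "space_power K R V k \<subseteq> F (m * n)"
        using power[of k] mono[of "m * k" "m * n"] by simp
    qed
    obtain Us where Us: "set Us \<subseteq> carrier R" "F (m * n) \<subseteq> Span K Us" "length Us \<le> (m * n + 1) ^ e"
      using growth by blast
    have "dim K (lin_span K R ?S) \<le> length Us"
    proof (rule dim_le_length[OF K _ Us(1)])
      show "subalgebra K (lin_span K R ?S) R"
        using S subalgebra_in_carrier[OF sub] subfieldE(3)[OF K]
        by (intro lin_span_subalgebra) blast+
      show "lin_span K R ?S \<subseteq> Span K Us"
        using lin_span_min[OF sub S] Us(2) by blast
    qed
    with Us(3) show ?thesis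
      by simp
  qed
  then have "ereal_log n (dim K (lin_span K R (\<Union>k\<le>n. space_power K R V k))) \<le> ereal (2 * real e)"
    if "m + 2 \<le> n" for n
    using that by (rule ereal_log_le)
  then have "\<forall>\<^sub>F n in sequentially.
      ereal_log n (dim K (lin_span K R (\<Union>k\<le>n. space_power K R V k))) \<le> ereal (2 * real e)"
    using eventually_sequentially by blast
  then show "limsup (\<lambda>n. ereal_log n (dim K (lin_span K R (\<Union>k\<le>n. space_power K R V k))))
      \<le> ereal (2 * real e)"
    by (rule Limsup_bounded)
qed

section \<open>The zero ring\<close>

lemma (in ring) zero_in_dimension: "dimension n K E \<Longrightarrow> \<zero> \<in> K \<Longrightarrow> \<zero> \<in> E"
proof (induction rule: dimension.induct)
  case (Suc_dim v E n K)
  then have "\<zero> = \<zero> \<otimes> v \<oplus> \<zero>"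
    by simp
  then show ?case
    using Suc_dim.IH Suc_dim.prems unfolding line_extension_mem_iff by blast
qed simp

text \<open>Covers the case that \<open>J\<close> is all of \<open>UW\<close>. All spaces are then
  \<open>{0}\<close>, and the dimension is computed from its inductive definition because the
  scalars form no subfield.\<close>

lemma (in ring) GKdim_zero_ring:
  assumes K: "K \<subseteq> carrier R" "\<zero> \<in> K" and "\<one> = \<zero>"
  shows "GKdim K R = - \<infinity>"
proof -
  have R: "carrier R = {\<zero>}"
    using assms(3) one_zeroD by simp
  have dim: "dim K {\<zero>} = 0"
    unfolding dim_def
  proof (rule the_equality)
    show "dimension 0 K {\<zero>}"
      by (rule zero_dim)
    fix n assume "dimension n K {\<zero>}"
    then show "n = 0"
    proof cases
      \<comment> \<open>An extension step would need a vector outside \<open>E\<close>, but the only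
        vector is zero and it lies in \<open>E\<close>.\<close>
      case (Suc_dim v E n)
      have "\<zero> \<in> E"
        using Suc_dim(5) K(2) by (rule zero_in_dimension)
      moreover have "v = \<zero>"
        using Suc_dim(3) R by simp
      ultimately show ?thesis
        using Suc_dim(4) by simp
    qed
  qed
  have span: "lin_span K R S = {\<zero>}" if "S \<subseteq> carrier R" for S
  proof -
    have "subalgebra K (lin_span K R S) R"
      using K(1) that by (rule lin_span_subalgebra)
    then have "\<zero> \<in> lin_span K R S" "lin_span K R S \<subseteq> carrier R"
      using subgroup.one_closed[of _ "add_monoid R"] subalgebra_in_carrier
      by (auto simp: subalgebra_def)
    then show ?thesis
      using R by auto
  qed
  have power: "space_power K R V k \<subseteq> carrier R" if "V \<subseteq> carrier R" for V k
  proof (induction k)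
    case (Suc k)
    then have "{x \<otimes> y |x y. x \<in> space_power K R V k \<and> y \<in> V} \<subseteq> carrier R"
      using that by auto
    then show ?case
      using span R by simp
  qed (use K in simp)
  have "limsup (\<lambda>n. ereal_log n (dim K (lin_span K R (\<Union>k\<le>n. space_power K R V k)))) = - \<infinity>"
    if "subalgebra K V R" for V
  proof -
    have "lin_span K R (\<Union>k\<le>n. space_power K R V k) = {\<zero>}" for n
      using power[OF subalgebra_in_carrier[OF that]] by (intro span) blast
    then show ?thesis
      by (simp add: dim ereal_log_def Limsup_const)
  qed
  then have "GKdim K R \<le> - \<infinity>"
    unfolding GKdim_def by (intro SUP_least) auto
  then show ?thesis
    by simp
qed


section \<open>Quotients of the enveloping algebra\<close>

lemma ring_of_type_algebra_simps [simp]: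
  "carrier ring_of_type_algebra = UNIV"
  "x \<otimes>\<^bsub>ring_of_type_algebra\<^esub> y = x * y"
  "x \<oplus>\<^bsub>ring_of_type_algebra\<^esub> y = x + y"
  "\<one>\<^bsub>ring_of_type_algebra\<^esub> = 1"
  "\<zero>\<^bsub>ring_of_type_algebra\<^esub> = 0"
  by (simp_all add: ring_of_type_algebra_def)

lemma tensor_of_witt_single: "tensor_of_witt (Poly_Mapping.single i c) = term_of c [i]"
  by (simp add: tensor_of_witt_def term_of_def)

lemma lie_congruence_lie_ideal: "lie_congruence (lie_ideal :: 'k::field_char_0 tensor set)"
proof -
  interpret ideal "lie_ideal :: 'k tensor set" "TW :: 'k tensor ring"
    by (rule ideal_lie_ideal)
  show ?thesis
  proof
    show "0 \<in> (lie_ideal :: 'k tensor set)"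
      using additive_subgroup.zero_closed[OF is_additive_subgroup] by simp
    show "p + q \<in> lie_ideal" if "p \<in> lie_ideal" "q \<in> lie_ideal" for p q :: "'k tensor"
      using additive_subgroup.a_closed[OF is_additive_subgroup that] by simp
    show "a * p \<in> lie_ideal" "p * a \<in> lie_ideal" if "p \<in> lie_ideal" for a p :: "'k tensor"
      using I_l_closed[OF that, of a] I_r_closed[OF that, of a] by simp_all
    fix i j
    have "term_of 1 [i, j] - term_of 1 [j, i]
        - term_of (of_nat (nat_of_pnat j) - of_nat (nat_of_pnat i)) [i + j]
      \<in> (lie_relations :: 'k tensor set)"
      unfolding lie_relations_def
      by (rule CollectI, rule exI[of _ "basis_elt i"], rule exI[of _ "basis_elt j"])
         (simp add: bracket_basis_elt tensor_of_witt_single)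
    then show "term_of 1 [i, j] - term_of 1 [j, i]
        - term_of (of_nat (nat_of_pnat j) - of_nat (nat_of_pnat i)) [i + j]
      \<in> (lie_ideal :: 'k tensor set)"
      using genideal_self[of lie_relations] by (auto simp: lie_ideal_def)
  qed
qed

lemma (in lie_congruence) lie_congruence_superset:
  assumes "I \<subseteq> I'" "0 \<in> I'" "\<And>p q. p \<in> I' \<Longrightarrow> q \<in> I' \<Longrightarrow> p + q \<in> I'"
    and "\<And>p a. p \<in> I' \<Longrightarrow> a * p \<in> I'" "\<And>p a. p \<in> I' \<Longrightarrow> p * a \<in> I'"
  shows "lie_congruence I'"
  using assms relation by unfold_locales auto

lemma ring_hom_ring_UW_class:
  "ring_hom_ring (TW :: 'k::field_char_0 tensor ring) UW UW_class"
  using ring_ring_of_type_algebra ring_UW UW_class_hom by (rule ring_hom_ringI2)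

lemma UW_class_eq_zero_iff: "UW_class p = \<zero>\<^bsub>UW\<^esub> \<longleftrightarrow> p \<in> lie_ideal"
proof -
  interpret ideal lie_ideal TW
    by (rule ideal_lie_ideal)
  show ?thesis
    using a_rcos_self[of p] a_coset_join2[of p lie_ideal] a_subgroup
    by (auto simp: UW_class_def UW_def FactRing_def is_additive_subgroup)
qed

lemma carrier_UW: "carrier UW = range UW_class"
  by (auto simp: UW_def FactRing_def A_RCOSETS_def' UW_class_def)

section \<open>From tensors to the quotient of \<open>UW\<close> by \<open>J\<close>\<close>

definition proj :: "'k::field_char_0 tensor set set \<Rightarrow> 'k tensor \<Rightarrow> 'k tensor set set" where
  "proj J p = J +>\<^bsub>UW\<^esub> UW_class p"

context
  fixes J :: "'k::field_char_0 tensor set set"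
  assumes J: "ideal J UW"
begin

interpretation J: ideal J "UW :: 'k tensor set ring"
  by (rule J)

interpretation R: ring "UW Quot J"
  by (rule J.quotient_is_ring)

interpretation proj: ring_hom_ring "TW :: 'k tensor ring" "UW Quot J" "proj J"
proof (rule ring_hom_ringI2)
  have "proj J = (+>\<^bsub>UW\<^esub>) J \<circ> UW_class"
    by (simp add: fun_eq_iff proj_def)
  then show "proj J \<in> ring_hom TW (UW Quot J)"
    using ring_hom_trans[OF UW_class_hom J.rcos_ring_hom] by simp
qed (simp_all add: ring_ring_of_type_algebra R.ring_axioms)

lemma zero_in_J: "\<zero>\<^bsub>UW\<^esub> \<in> J"
  by (rule additive_subgroup.zero_closed[OF J.is_additive_subgroup])

text \<open>The kernel of \<open>proj J\<close>: pulled back to tensors, \<open>J\<close> becomes an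
  ideal containing the Lie relations, to which the rewriting results apply.\<close>

definition kernel_ideal :: "'k tensor set" where
  "kernel_ideal = {p. UW_class p \<in> J}"

lemma proj_eq_zero_iff: "proj J p = \<zero>\<^bsub>UW Quot J\<^esub> \<longleftrightarrow> p \<in> kernel_ideal"
  using J.a_rcos_self[of "UW_class p"] J.a_coset_join2[of "UW_class p" J] J.a_subgroup
  by (auto simp: proj_def kernel_ideal_def FactRing_def carrier_UW J.is_additive_subgroup)

lemma lie_ideal_subset_kernel_ideal: "lie_ideal \<subseteq> kernel_ideal"
proof
  fix p :: "'k tensor"
  assume "p \<in> lie_ideal"
  then have "UW_class p = \<zero>\<^bsub>UW\<^esub>"
    by (simp add: UW_class_eq_zero_iff)
  then show "p \<in> kernel_ideal"
    using zero_in_J by (simp add: kernel_ideal_def)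
qed

lemma lie_congruence_kernel_ideal: "lie_congruence kernel_ideal"
proof (rule lie_congruence.lie_congruence_superset[OF lie_congruence_lie_ideal])
  interpret c: ring_hom_ring "TW :: 'k tensor ring" UW UW_class
    by (rule ring_hom_ring_UW_class)
  show "lie_ideal \<subseteq> kernel_ideal"
    by (rule lie_ideal_subset_kernel_ideal)
  then show "0 \<in> kernel_ideal"
    using lie_congruence.zero_closed[OF lie_congruence_lie_ideal] by auto
  show "p + q \<in> kernel_ideal" if "p \<in> kernel_ideal" "q \<in> kernel_ideal" for p q
    using that c.hom_add[of p q] additive_subgroup.a_closed[OF J.is_additive_subgroup] by (simp add: kernel_ideal_def)
  show "a * p \<in> kernel_ideal" "p * a \<in> kernel_ideal" if "p \<in> kernel_ideal" for a p
    using that c.hom_mult[of a p] c.hom_mult[of p a] J.I_l_closed J.I_r_closed c.hom_closed[of a]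
    by (simp_all add: kernel_ideal_def)
qed

interpretation I: lie_congruence kernel_ideal
  by (rule lie_congruence_kernel_ideal)

lemma proj_eq:
  assumes "p - q \<in> kernel_ideal"
  shows "proj J p = proj J q"
proof -
  have "proj J p = proj J (p - q) \<oplus>\<^bsub>UW Quot J\<^esub> proj J q"
    using proj.hom_add[of "p - q" q] by simp
  then show ?thesis
    using assms by (simp add: proj_eq_zero_iff[symmetric])
qed

lemma carrier_quotient: "carrier (UW Quot J) = range (proj J)"
  by (auto simp: FactRing_def A_RCOSETS_def' carrier_UW proj_def)

lemma UW_quot_scalars_eq: "UW_quot_scalars J = range (\<lambda>c. proj J (term_of c []))"
  by (simp add: UW_quot_scalars_def UW_scalars_def proj_def image_image term_of_def zero_free_monoid_def)

text \<open>The scalars are the image of a field under a ring homomorphism, and the target is not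
  the zero ring.\<close>

lemma subfield_scalars:
  assumes "\<one>\<^bsub>UW Quot J\<^esub> \<noteq> \<zero>\<^bsub>UW Quot J\<^esub>"
  shows "subfield (UW_quot_scalars J) (UW Quot J)"
proof -
  interpret k: field "ring_of_type_algebra :: 'k ring"
    by (rule field_from_type_algebra)
  interpret h: ring_hom_ring "ring_of_type_algebra :: 'k ring" "UW Quot J" "\<lambda>c. proj J (term_of c [])"
  proof (rule ring_hom_ringI2)
    show "(\<lambda>c. proj J (term_of c [])) \<in> ring_hom ring_of_type_algebra (UW Quot J)"
      using proj.hom_mult[of "term_of _ []" "term_of _ []"] proj.hom_add[of "term_of _ []" "term_of _ []"]
        proj.hom_one
      by (intro ring_hom_memI) (auto simp: term_of_add one_eq_term_of carrier_quotient)
  qed (simp_all add: k.ring_axioms R.ring_axioms)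
  show ?thesis
    using h.img_is_subfield(2)[OF k.carrier_is_subfield assms] by (simp add: UW_quot_scalars_eq)
qed

section \<open>The degree filtration of the quotient\<close>

text \<open>Degree is used rather than length because only finitely many words have degree at most
  \<open>N\<close>, whereas there are infinitely many of length 1.\<close>

definition degree_filtration :: "nat \<Rightarrow> 'k tensor set set set" where
  "degree_filtration N = proj J ` {p. \<forall>w\<in>Poly_Mapping.keys p. wdeg (letters w) \<le> N}"

lemma subalgebra_degree_filtration:
  "subalgebra (UW_quot_scalars J) (degree_filtration N) (UW Quot J)"
proof -
  let ?A = "{p :: 'k tensor. \<forall>w\<in>Poly_Mapping.keys p. wdeg (letters w) \<le> N}"
  have "subalgebra (range (\<lambda>c. term_of c [])) ?A (TW :: 'k tensor ring)"
  proof -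
    have "subgroup ?A (add_monoid TW)"
    proof (rule subgroup.intro)
      show "p \<otimes>\<^bsub>add_monoid TW\<^esub> q \<in> ?A" if "p \<in> ?A" "q \<in> ?A" for p q :: "'k tensor"
        using that keys_add[of p q] by auto
      show "inv\<^bsub>add_monoid TW\<^esub> p \<in> ?A" if "p \<in> ?A" for p :: "'k tensor"
      proof -
        have "\<ominus>\<^bsub>TW\<^esub> p = - p"
          by (rule proj.R.minus_equality) simp_all
        then show ?thesis
          using that by (simp add: a_inv_def)
      qed
    qed auto
    moreover have "term_of c [] * p \<in> ?A" if "p \<in> ?A" for c p
    proof
      show "\<forall>w\<in>Poly_Mapping.keys (term_of c [] * p). wdeg (letters w) \<le> N"
        using that keys_mult[of "term_of c []" p]
        by (auto simp: term_of_def plus_free_monoid_def split: if_splits)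
    qed
    ultimately show ?thesis
      by (auto simp: subalgebra_def subalgebra_axioms_def)
  qed
  from proj.img_is_subalgebra[OF _ this] show ?thesis
    by (simp add: degree_filtration_def UW_quot_scalars_eq image_image)
qed

lemma degree_filtration_mult:
  assumes "x \<in> degree_filtration M" "y \<in> degree_filtration N"
  shows "x \<otimes>\<^bsub>UW Quot J\<^esub> y \<in> degree_filtration (M + N)"
proof -
  obtain p q where p: "x = proj J p" "\<forall>w\<in>Poly_Mapping.keys p. wdeg (letters w) \<le> M"
    and q: "y = proj J q" "\<forall>w\<in>Poly_Mapping.keys q. wdeg (letters w) \<le> N"
    using assms unfolding degree_filtration_def by auto
  have "wdeg (letters w) \<le> M + N" if w: "w \<in> Poly_Mapping.keys (p * q)" for w
  proof -
    obtain u v where "w = u + v" "u \<in> Poly_Mapping.keys p" "v \<in> Poly_Mapping.keys q"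
      using keys_mult[of p q] w by blast
    then show ?thesis
      using p(2) q(2) by (auto simp: plus_free_monoid_def intro: add_mono)
  qed
  moreover have "x \<otimes>\<^bsub>UW Quot J\<^esub> y = proj J (p * q)"
    using proj.hom_mult[of p q] p(1) q(1) by simp
  ultimately show ?thesis
    unfolding degree_filtration_def by blast
qed

lemma degree_filtration_exhaust: "carrier (UW Quot J) \<subseteq> (\<Union>N. degree_filtration N)"
proof
  fix x
  assume "x \<in> carrier (UW Quot J)"
  then obtain p where p: "x = proj J p"
    by (auto simp: carrier_quotient)
  have "wdeg (letters w) \<le> Max ((\<lambda>w. wdeg (letters w)) ` Poly_Mapping.keys p)"
    if "w \<in> Poly_Mapping.keys p" for w
    using that by (intro Max_ge) auto
  then show "x \<in> (\<Union>N. degree_filtration N)"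
    unfolding degree_filtration_def p by blast
qed

text \<open>The images of the irreducible words of degree at most \<open>N\<close> span. They may be
  dependent in the quotient, which is harmless for an upper bound.\<close>

lemma degree_filtration_growth:
  assumes one: "\<one>\<^bsub>UW Quot J\<^esub> \<noteq> \<zero>\<^bsub>UW Quot J\<^esub>"
    and irred: "\<And>p N. (\<And>w. w \<in> Poly_Mapping.keys p \<Longrightarrow> wdeg (letters w) \<le> N)
      \<Longrightarrow> p \<in> I.spanned {v \<in> irreducible_words C r. wdeg v \<le> N}"
  shows "\<exists>Us. set Us \<subseteq> carrier (UW Quot J) \<and> degree_filtration N \<subseteq> R.Span (UW_quot_scalars J) Us
    \<and> length Us \<le> (N + 1) ^ (C + r)"
proof -
  let ?A = "{v \<in> irreducible_words C r. wdeg v \<le> N}"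
  let ?K = "UW_quot_scalars J"
  obtain vs where vs: "set vs = ?A" "distinct vs"
    using finite_distinct_list[OF card_irreducible_words_le(1)] by blast
  define Us where "Us = map (\<lambda>v. proj J (term_of 1 v)) vs"
  have Us: "set Us \<subseteq> carrier (UW Quot J)"
    by (auto simp: Us_def carrier_quotient)
  have len: "length Us \<le> (N + 1) ^ (C + r)"
    using card_irreducible_words_le(2)[of C r N] distinct_card[OF vs(2)] vs(1) by (simp add: Us_def)
  note K = subfield_scalars[OF one]
  have span_term: "proj J (term_of c v) \<in> R.Span ?K Us" if "v \<in> ?A" for c v
  proof -
    have "proj J (term_of 1 v) \<in> R.Span ?K Us"
      using R.Span_base_incl[OF K Us] that vs(1) by (auto simp: Us_def)
    then have "proj J (term_of c []) \<otimes>\<^bsub>UW Quot J\<^esub> proj J (term_of 1 v) \<in> R.Span ?K Us"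
      by (intro R.Span_smult_closed[OF K Us]) (auto simp: UW_quot_scalars_eq)
    then show ?thesis
      using proj.hom_mult[of "term_of c []" "term_of 1 v"] by simp
  qed
  have "degree_filtration N \<subseteq> R.Span ?K Us"
  proof
    fix x
    assume "x \<in> degree_filtration N"
    then obtain p where p: "x = proj J p" "\<forall>w\<in>Poly_Mapping.keys p. wdeg (letters w) \<le> N"
      unfolding degree_filtration_def by blast
    from p(2) have "p \<in> I.spanned ?A"
      by (intro irred) simp
    then obtain q where q: "p - q \<in> kernel_ideal" "\<forall>w\<in>Poly_Mapping.keys q. letters w \<in> ?A"
      unfolding I.spanned_def by blast
    have "proj J (\<Sum>w\<in>W. term_of (Poly_Mapping.lookup q w) (letters w)) \<in> R.Span ?K Us"
      if "W \<subseteq> Poly_Mapping.keys q" for W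
      using finite_subset[OF that finite_keys] that
    proof (induction W rule: finite_induct)
      case empty
      then show ?case
        using R.Span_subgroup_props(2)[OF K Us] proj.hom_zero by simp
    next
      case (insert w W)
      have "proj J (term_of (Poly_Mapping.lookup q w) (letters w)) \<in> R.Span ?K Us"
        using insert.prems q(2) by (intro span_term) auto
      then show ?case
        using insert R.Span_subgroup_props(3)[OF K Us] proj.hom_add by simp
    qed
    from this[OF order_refl] have "proj J q \<in> R.Span ?K Us"
      by (simp flip: sum_term_of_keys)
    then show "x \<in> R.Span ?K Us"
      using proj_eq[OF q(1)] p(1) by simp
  qed
  with Us len show ?thesis
    by blast
qed

lemma GKdim_quotient_less_infinity:
  assumes "J \<noteq> {\<zero>\<^bsub>UW\<^esub>}"
  shows "GKdim (UW_quot_scalars J) (UW Quot J) < \<infinity>"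
proof (cases "\<one>\<^bsub>UW Quot J\<^esub> = \<zero>\<^bsub>UW Quot J\<^esub>")
  case True
  \<comment> \<open>The quotient is the zero ring, where the filtration argument would lack a
    subfield of scalars.\<close>
  have "UW_quot_scalars J \<subseteq> carrier (UW Quot J)"
    by (auto simp: UW_quot_scalars_eq carrier_quotient)
  moreover have "\<zero>\<^bsub>UW Quot J\<^esub> \<in> UW_quot_scalars J"
    unfolding UW_quot_scalars_eq using proj.hom_zero by (intro range_eqI[of _ _ 0]) simp
  ultimately have "GKdim (UW_quot_scalars J) (UW Quot J) = - \<infinity>"
    using True by (rule R.GKdim_zero_ring)
  then show ?thesis
    by simp
next
  case False
  interpret L: lie_congruence "lie_ideal :: 'k tensor set"
    by (rule lie_congruence_lie_ideal)
  obtain a where a: "a \<in> J" "a \<noteq> \<zero>\<^bsub>UW\<^esub>"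
    using assms zero_in_J by blast
  then obtain p where "a = UW_class p"
    using J.a_subset unfolding carrier_UW by blast
  with a have p: "UW_class p \<in> J" "p \<notin> lie_ideal"
    by (simp_all add: UW_class_eq_zero_iff)
  \<comment> \<open>Sorting is done modulo \<open>lie_ideal\<close>, not modulo the larger
    \<open>kernel_ideal\<close>: since \<open>p\<close> is not in \<open>lie_ideal\<close>, the
    sorted \<open>q\<close> cannot be zero.\<close>
  obtain q where q: "p - q \<in> lie_ideal" "\<And>w. w \<in> Poly_Mapping.keys q \<Longrightarrow> sorted (letters w)"
    using L.spanned_sorted[of p] unfolding L.spanned_def by blast
  have "p - q \<in> kernel_ideal"
    using q(1) lie_ideal_subset_kernel_ideal by blast
  moreover have "p \<in> kernel_ideal"
    using p(1) by (simp add: kernel_ideal_def)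
  ultimately have "q \<in> kernel_ideal" "q \<noteq> 0"
    using I.diff_closed[of p "p - q"] p(2) q(1) by auto
  from I.spanned_by_irreducible[OF this q(2)] obtain C r where
    irred: "\<And>p N. (\<And>w. w \<in> Poly_Mapping.keys p \<Longrightarrow> wdeg (letters w) \<le> N)
      \<Longrightarrow> p \<in> I.spanned {v \<in> irreducible_words C r. wdeg v \<le> N}"
    by blast
  have "GKdim (UW_quot_scalars J) (UW Quot J) \<le> ereal (2 * real (C + r))"
  proof (rule R.GKdim_filtration_le)
    show "subfield (UW_quot_scalars J) (UW Quot J)"
      by (rule subfield_scalars[OF False])
    show "subalgebra (UW_quot_scalars J) (degree_filtration N) (UW Quot J)" for N
      by (rule subalgebra_degree_filtration)
    show "degree_filtration M \<subseteq> degree_filtration N" if "M \<le> N" for M N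
      unfolding degree_filtration_def using that by (intro image_mono) force
    show "UW_quot_scalars J \<subseteq> degree_filtration 0"
      unfolding UW_quot_scalars_eq degree_filtration_def by (auto simp: term_of_def)
    show "\<exists>Us. set Us \<subseteq> carrier (UW Quot J) \<and> degree_filtration N \<subseteq> R.Span (UW_quot_scalars J) Us
        \<and> length Us \<le> (N + 1) ^ (C + r)" for N
      using False irred by (rule degree_filtration_growth)
  qed (simp_all add: degree_filtration_mult degree_filtration_exhaust)
  then show ?thesis
    by (rule order_le_less_trans) simp
qed

end

theorem corollary3p21:
  fixes J :: "'k::field_char_0 tensor set set"
  assumes "ideal J UW"
    and "J \<noteq> {\<zero>\<^bsub>UW\<^esub>}"
    and "radical_ideal (gr_o (gr_d J)) SW"
  shows "GKdim (UW_quot_scalars J) (UW Quot J) < \<infinity>"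
  using assms(1,2) by (rule GKdim_quotient_less_infinity)

end
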